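(* Let $n,N\ge1$. Let $S_N(n)$ be the set of permutations $\sigma\in S(n)$ having no decreasing subsequence of length $N+1$ (i.e. there are no indices $i_1<\dots<i_{N+1}$ with $\sigma(i_1)>\dots>\sigma(i_{N+1})$), and let $\mathsf G$ be the $|S_N(n)|\times|S_N(n)|$ matrix $\mathsf G=(N^{\#(\sigma\tau^{-1})})_{\sigma,\tau\in S_N(n)}$, where $\#(\rho)$ is the number of cycles (including fixed points) of $\rho$. Then $\mathsf G$ is invertible, and for all functions $i,j,i',j':\{1,\dots,n\}\to\{1,\dots,N\}$, $$\Big\langle \prod_{k=1}^n u_{i(k)j(k)}\overline{u_{i'(k)j'(k)}}\Big\rangle_N=\sum_{\sigma,\tau\in S_N(n)}[i=i'\circ\sigma]\,[j=j'\circ\tau]\,(\mathsf G^{-1})_{\sigma,\tau}.$$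
   Context: $U=(u_{ab})$ is an $N\times N$ random unitary matrix distributed according to Haar probability measure on $\mathcal U(N)$ and $\langle\cdot\rangle_N$ denotes expectation. $S(n)$ is the symmetric group on $\{1,\dots,n\}$, with product given by composition. $[P]$ is $1$ if the statement $P$ is true and $0$ otherwise; $i'\circ\sigma$ is the function $k\mapsto i'(\sigma(k))$. *)

theory Defs
  imports "HOL-Probability.Probability" "HOL-Combinatorics.Orbits"
begin

definition unitary_group :: "(complex ^ 'N ^ 'N) set" where
  "unitary_group =
     {U. U ** transpose (map_matrix cnj U) = mat 1 \<and> transpose (map_matrix cnj U) ** U = mat 1}"

text \<open>A Haar probability measure is a left-invariant Borel probability measure on the (compact)
  unitary group. The equation for \<^term>\<open>sets M\<close> also forces the underlying space of \<^term>\<open>M\<close>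
  to be the unitary group.\<close>

definition haar_unitary :: "(complex ^ 'N ^ 'N) measure \<Rightarrow> bool" where
  "haar_unitary M \<longleftrightarrow>
     prob_space M \<and>
     sets M = sets (restrict_space borel unitary_group) \<and>
     (\<forall>V\<in>unitary_group. distr M M (\<lambda>U. V ** U) = M)"

definition perms_no_decreasing :: "nat \<Rightarrow> nat \<Rightarrow> (nat \<Rightarrow> nat) set" where
  "perms_no_decreasing N n =
     {\<sigma>. \<sigma> permutes {1..n} \<and>
         \<not> (\<exists>s. s ` {1..N + 1} \<subseteq> {1..n} \<and> strict_mono_on {1..N + 1} s \<and>
                strict_antimono_on {1..N + 1} (\<sigma> \<circ> s))}"

text \<open>Orbits are those of points of \<open>{1..n}\<close> only: permutations are functions on all of
  \<^typ>\<open>nat\<close>, and the fixed points outside \<open>{1..n}\<close> must not be counted.\<close>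

definition num_cycles :: "nat \<Rightarrow> (nat \<Rightarrow> nat) \<Rightarrow> nat" where
  "num_cycles n \<rho> = card (orbit \<rho> ` {1..n})"

definition gram_matrix :: "nat \<Rightarrow> nat \<Rightarrow> (nat \<Rightarrow> nat) \<Rightarrow> (nat \<Rightarrow> nat) \<Rightarrow> complex" where
  "gram_matrix N n \<sigma> \<tau> = of_nat N ^ num_cycles n (\<sigma> \<circ> inv \<tau>)"

text \<open>Square matrices with rows and columns indexed by a finite set \<open>S\<close> are binary functions of which
  only the values on \<open>S \<times> S\<close> matter. Below, \<open>inverse_on S A\<close> is determined only
  on \<open>S \<times> S\<close> (uniquely so, if \<open>A\<close> is invertible).\<close>

definition is_inverse_on ::
  "'a set \<Rightarrow> ('a \<Rightarrow> 'a \<Rightarrow> complex) \<Rightarrow> ('a \<Rightarrow> 'a \<Rightarrow> complex) \<Rightarrow> bool" where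
  "is_inverse_on S A B \<longleftrightarrow>
     (\<forall>x\<in>S. \<forall>y\<in>S. (\<Sum>z\<in>S. A x z * B z y) = of_bool (x = y) \<and>
                  (\<Sum>z\<in>S. B x z * A z y) = of_bool (x = y))"

definition invertible_on :: "'a set \<Rightarrow> ('a \<Rightarrow> 'a \<Rightarrow> complex) \<Rightarrow> bool" where
  "invertible_on S A \<longleftrightarrow> (\<exists>B. is_inverse_on S A B)"

definition inverse_on :: "'a set \<Rightarrow> ('a \<Rightarrow> 'a \<Rightarrow> complex) \<Rightarrow> 'a \<Rightarrow> 'a \<Rightarrow> complex" where
  "inverse_on S A = (SOME B. is_inverse_on S A B)"

end

theory Submission
  imports Defs "HOL-Library.Function_Algebras" "HOL-Library.Fun_Lexorder"
begin

text \<open>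
  View \<open>v\<^sub>\<sigma>(i, i') = [i = i' \<circ> \<sigma>]\<close> as an operator on the \<open>n\<close>-th tensor power of \<open>\<complex>\<^sup>N\<close>; the
  Gram matrix of these tensors is \<open>N\<^bsup>#(\<sigma>\<tau>\<inverse>)\<^esup>\<close>. Antisymmetrizing over \<open>N + 1\<close> positions gives zero,
  and straightening along decreasing subsequences shows that the \<open>v\<^sub>\<sigma>\<close> without decreasing
  subsequence of length \<open>N + 1\<close> span all of them. They are independent, since such a \<open>\<sigma>\<close> is
  increasing on the classes of an \<open>N\<close>-colouring, and evaluating at the colouring is unitriangular in
  the lexicographic order. Hence their Gram matrix has an inverse \<open>B\<close>, and the sum \<open>P(p, q)\<close> of
  \<open>v\<^sub>\<sigma>(p) B\<^sub>\<sigma>\<^sub>\<tau> v\<^sub>\<tau>(q)\<close> over \<open>\<sigma>\<close> and \<open>\<tau>\<close> is the reproducing kernel of their span.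

  For fixed \<open>q = (j, j')\<close> the moments form an operator \<open>W\<close> that commutes with all \<open>U\<^bsup>\<otimes>n\<^esup>\<close> by left
  invariance. Differentiating along unitary curves, \<open>W\<close> commutes with the action of all matrices,
  hence with all operators that are symmetric under permutation of the factors. The blocks of \<open>P\<close> are
  symmetric since a reproducing kernel is unique, so \<open>W = P W\<close>. This is the claim, because the inner
  product of \<open>W\<close> and \<open>v\<^sub>\<tau>\<close> is \<open>v\<^sub>\<tau>(q)\<close> by unitarity.
\<close>

section \<open>Gram matrices and reproducing kernels\<close>

lemma (in vector_space) subset_span_if_card_le:
  assumes "finite T" and "independent S" and "S \<subseteq> span T" and "card T \<le> card S"
  shows "T \<subseteq> span S"
proof
  fix a assume "a \<in> T"
  show "a \<in> span S"
  proof (rule ccontr)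
    assume a: "a \<notin> span S"
    then have "independent (insert a S)"
      using assms(2) by (rule independent_insertI)
    moreover have "insert a S \<subseteq> span T"
      using assms(3) \<open>a \<in> T\<close> by (simp add: span_base)
    ultimately have "finite (insert a S) \<and> card (insert a S) \<le> card T"
      by (rule independent_span_bound[OF assms(1)])
    moreover have "a \<notin> S" using a span_base by blast
    ultimately show False using assms(4) by auto
  qed
qed

interpretation complex_fun: vector_space "\<lambda>(c :: complex) f x. c * f x"
  by unfold_locales (auto simp: fun_eq_iff algebra_simps)

lemma sum_fun_apply: "(\<Sum>x\<in>A. f x) p = (\<Sum>x\<in>A. f x p)"
  by (induction A rule: infinite_finite_induct) auto

lemma subspace_linear_combination:
  assumes "complex_fun.subspace V" and "\<And>x. x \<in> A \<Longrightarrow> f x \<in> V"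
  shows "(\<lambda>p. \<Sum>x\<in>A. c x * f x p) \<in> V"
proof -
  have "(\<Sum>x\<in>A. (\<lambda>p. c x * f x p)) \<in> V"
    by (intro complex_fun.subspace_sum complex_fun.subspace_scale assms)
  also have "(\<Sum>x\<in>A. (\<lambda>p. c x * f x p)) = (\<lambda>p. \<Sum>x\<in>A. c x * f x p)"
    by (simp add: fun_eq_iff sum_fun_apply)
  finally show ?thesis .
qed

definition lin_indep_on :: "'p set \<Rightarrow> ('s \<Rightarrow> 'p \<Rightarrow> complex) \<Rightarrow> 's set \<Rightarrow> bool" where
  "lin_indep_on T v S \<longleftrightarrow>
     (\<forall>x. (\<forall>p\<in>T. (\<Sum>s\<in>S. x s * v s p) = 0) \<longrightarrow> (\<forall>s\<in>S. x s = 0))"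

lemma lin_indep_onD:
  assumes "lin_indep_on T v S" and "\<And>p. p \<in> T \<Longrightarrow> (\<Sum>s\<in>S. x s * v s p) = 0" and "s \<in> S"
  shows "x s = 0"
  using assms unfolding lin_indep_on_def by blast

lemma lin_indep_on_cong:
  assumes "\<And>s p. s \<in> S \<Longrightarrow> p \<in> T \<Longrightarrow> v s p = w s p"
  shows "lin_indep_on T v S \<longleftrightarrow> lin_indep_on T w S"
  using assms by (simp add: lin_indep_on_def cong: sum.cong)

lemma sum_of_bool_delta:
  fixes f :: "'a \<Rightarrow> 'b::semiring_1"
  assumes "finite S" and "u \<in> S"
  shows "(\<Sum>s\<in>S. of_bool (s = u) * f s) = f u" and "(\<Sum>s\<in>S. of_bool (u = s) * f s) = f u"
    and "(\<Sum>s\<in>S. f s * of_bool (s = u)) = f u" and "(\<Sum>s\<in>S. f s * of_bool (u = s)) = f u"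
  using assms by (simp_all add: of_bool_def if_distrib if_distribR cong: if_cong)

lemma independent_image_if_lin_indep_on:
  assumes "finite S" and "lin_indep_on T v S"
  shows "inj_on v S" and "complex_fun.independent (v ` S)"
proof -
  show inj: "inj_on v S"
  proof (rule inj_onI, rule ccontr)
    fix s t assume st: "s \<in> S" "t \<in> S" "v s = v t" "s \<noteq> t"
    have "of_bool (s = s) - of_bool (s = t) = (0 :: complex)"
    proof (rule lin_indep_onD[OF assms(2) _ st(1), of "\<lambda>r. of_bool (r = s) - of_bool (r = t)"])
      show "(\<Sum>r\<in>S. (of_bool (r = s) - of_bool (r = t)) * v r p) = 0" for p
        using st by (simp add: left_diff_distrib sum_subtractf sum_of_bool_delta assms(1))
    qed
    with st(4) show False by simp
  qed
  show "complex_fun.independent (v ` S)"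
  proof (rule complex_fun.independent_if_scalars_zero)
    fix c w assume zero: "(\<Sum>w\<in>v ` S. (\<lambda>p. c w * w p)) = 0" and "w \<in> v ` S"
    then obtain s where s: "s \<in> S" "w = v s" by blast
    have "(\<Sum>s\<in>S. c (v s) * v s p) = 0" for p
      using fun_cong[OF zero, of p] by (simp add: sum.reindex[OF inj] sum_fun_apply)
    then show "c w = 0"
      unfolding s(2) by (rule lin_indep_onD[OF assms(2) _ s(1)])
  qed (use assms(1) in simp)
qed

text \<open>The rows, cut off outside \<open>S\<close>, are as many independent elements of the span of the unit vectors
  as there are unit vectors.\<close>

lemma left_inverse_if_rows_independent:
  fixes A :: "'a \<Rightarrow> 'a \<Rightarrow> complex"
  assumes "finite S" and "lin_indep_on S A S"
  shows "\<exists>B. \<forall>u\<in>S. \<forall>t\<in>S. (\<Sum>s\<in>S. B u s * A s t) = of_bool (u = t)"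
proof -
  define row where "row = (\<lambda>s t. of_bool (t \<in> S) * A s t)"
  define unit where "unit = (\<lambda>u t :: 'a. of_bool (u = t) :: complex)"
  have "lin_indep_on S row S"
    using assms(2) by (simp add: row_def cong: lin_indep_on_cong)
  note rows = independent_image_if_lin_indep_on[OF assms(1) this]
  have row_in: "row ` S \<subseteq> complex_fun.span (unit ` S)"
  proof (rule image_subsetI)
    fix s assume "s \<in> S"
    have "(\<lambda>t. \<Sum>u\<in>S. A s u * unit u t) \<in> complex_fun.span (unit ` S)"
      by (intro subspace_linear_combination complex_fun.subspace_span complex_fun.span_base) auto
    also have "(\<lambda>t. \<Sum>u\<in>S. A s u * unit u t) = row s"
      using assms(1) by (auto simp: row_def unit_def fun_eq_iff sum_of_bool_delta intro: sum.neutral)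
    finally show "row s \<in> complex_fun.span (unit ` S)" .
  qed
  have "card (unit ` S) \<le> card (row ` S)"
    using card_image_le[OF assms(1)] card_image[OF rows(1)] by metis
  then have unit_in: "unit ` S \<subseteq> complex_fun.span (row ` S)"
    by (intro complex_fun.subset_span_if_card_le[OF finite_imageI[OF assms(1)] rows(2) row_in])
  have "\<exists>b. \<forall>t\<in>S. (\<Sum>s\<in>S. b s * A s t) = of_bool (u = t)" if "u \<in> S" for u
  proof -
    have "unit u \<in> range (\<lambda>c. \<Sum>w\<in>row ` S. (\<lambda>p. c w * w p))"
      using unit_in that assms(1) complex_fun.span_finite[of "row ` S"] by blast
    then obtain c where c: "unit u = (\<Sum>w\<in>row ` S. (\<lambda>p. c w * w p))"
      by blast
    have "(\<Sum>s\<in>S. c (row s) * A s t) = of_bool (u = t)" if "t \<in> S" for t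
      using fun_cong[OF c, of t] that unfolding sum_fun_apply sum.reindex[OF rows(1)] o_def
      by (simp add: row_def unit_def)
    then show ?thesis by (intro exI[of _ "\<lambda>s. c (row s)"]) blast
  qed
  then show ?thesis by metis
qed

lemma invertible_on_if_rows_independent:
  assumes "finite S" and "lin_indep_on S A S"
  shows "invertible_on S A"
proof -
  obtain B where left: "\<And>x y. x \<in> S \<Longrightarrow> y \<in> S \<Longrightarrow> (\<Sum>z\<in>S. B x z * A z y) = of_bool (x = y)"
    using left_inverse_if_rows_independent[OF assms] by blast
  have "(\<Sum>z\<in>S. A x z * B z y) = of_bool (x = y)" if "x \<in> S" "y \<in> S" for x y
  proof -
    have "(\<Sum>z\<in>S. A x z * B z y) - of_bool (x = y) = 0"
    proof (rule lin_indep_onD[OF assms(2) _ that(2)])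
      fix t assume t: "t \<in> S"
      have "(\<Sum>y\<in>S. (\<Sum>z\<in>S. A x z * B z y) * A y t) = (\<Sum>z\<in>S. A x z * (\<Sum>y\<in>S. B z y * A y t))"
        unfolding sum_distrib_left sum_distrib_right by (subst sum.swap) (simp only: mult.assoc)
      also have "\<dots> = A x t"
        using assms(1) t by (simp add: left sum_of_bool_delta)
      finally show "(\<Sum>y\<in>S. ((\<Sum>z\<in>S. A x z * B z y) - of_bool (x = y)) * A y t) = 0"
        using assms(1) that(1) by (simp add: left_diff_distrib sum_subtractf sum_of_bool_delta)
    qed
    then show ?thesis by simp
  qed
  with left show ?thesis
    unfolding invertible_on_def is_inverse_on_def by blast
qed

lemma is_inverse_on_inverse_on:
  "invertible_on S A \<Longrightarrow> is_inverse_on S A (inverse_on S A)"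
  unfolding invertible_on_def inverse_on_def by (rule someI_ex[of "is_inverse_on S A"])

lemma lin_indep_on_gram:
  assumes "finite T" and "lin_indep_on T v S"
  shows "lin_indep_on S (\<lambda>s t. \<Sum>p\<in>T. v s p * cnj (v t p)) S"
  unfolding lin_indep_on_def
proof (intro allI impI)
  fix x assume orth: "\<forall>t\<in>S. (\<Sum>s\<in>S. x s * (\<Sum>p\<in>T. v s p * cnj (v t p))) = 0"
  define y where "y = (\<lambda>p. \<Sum>s\<in>S. x s * v s p)"
  have y_orth: "(\<Sum>p\<in>T. y p * cnj (v t p)) = 0" if "t \<in> S" for t
    using orth that unfolding y_def sum_distrib_left sum_distrib_right
    by (subst sum.swap) (simp only: mult.assoc)
  have "complex_of_real (\<Sum>p\<in>T. (cmod (y p))\<^sup>2) = (\<Sum>p\<in>T. y p * cnj (y p))"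
    by (simp only: of_real_sum complex_norm_square)
  also have "\<dots> = (\<Sum>t\<in>S. cnj (x t) * (\<Sum>p\<in>T. y p * cnj (v t p)))"
    unfolding y_def[THEN fun_cong, THEN arg_cong[where f = cnj]]
      cnj_sum complex_cnj_mult sum_distrib_left
    by (subst sum.swap) (simp only: mult.left_commute)
  also have "\<dots> = 0"
    by (intro sum.neutral ballI) (simp add: y_orth)
  finally have "(\<Sum>p\<in>T. (cmod (y p))\<^sup>2) = 0"
    by (simp only: of_real_eq_0_iff)
  then have "\<forall>p\<in>T. y p = 0"
    using assms(1) by (simp add: sum_nonneg_eq_0_iff)
  then show "\<forall>s\<in>S. x s = 0"
    using assms(2) unfolding lin_indep_on_def y_def by blast
qed

definition gram_kernel ::
  "'s set \<Rightarrow> ('s \<Rightarrow> 's \<Rightarrow> complex) \<Rightarrow> ('s \<Rightarrow> 'p \<Rightarrow> complex) \<Rightarrow> 'p \<Rightarrow> 'p \<Rightarrow> complex" where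
  "gram_kernel S B v q p = (\<Sum>s\<in>S. \<Sum>t\<in>S. v s q * B s t * v t p)"

lemma gram_kernel_in_span:
  "(\<lambda>q. gram_kernel S B v q p) \<in> complex_fun.span (v ` S)"
  "(\<lambda>p. gram_kernel S B v q p) \<in> complex_fun.span (v ` S)"
proof -
  have "(\<lambda>q. \<Sum>s\<in>S. (\<Sum>t\<in>S. B s t * v t p) * v s q) \<in> complex_fun.span (v ` S)"
    by (intro subspace_linear_combination complex_fun.subspace_span complex_fun.span_base) auto
  then show "(\<lambda>q. gram_kernel S B v q p) \<in> complex_fun.span (v ` S)"
    by (simp add: gram_kernel_def sum_distrib_left sum_distrib_right mult_ac)
  have "(\<lambda>p. \<Sum>t\<in>S. (\<Sum>s\<in>S. v s q * B s t) * v t p) \<in> complex_fun.span (v ` S)"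
    by (intro subspace_linear_combination complex_fun.subspace_span complex_fun.span_base) auto
  also have "(\<lambda>p. \<Sum>t\<in>S. (\<Sum>s\<in>S. v s q * B s t) * v t p) = gram_kernel S B v q"
    unfolding gram_kernel_def fun_eq_iff sum_distrib_right by (intro allI sum.swap)
  finally show "(\<lambda>p. gram_kernel S B v q p) \<in> complex_fun.span (v ` S)" .
qed

lemma sum_gram_kernel_left:
  "(\<Sum>p\<in>T. gram_kernel S B v q p * f p) = (\<Sum>s\<in>S. \<Sum>t\<in>S. v s q * B s t * (\<Sum>p\<in>T. v t p * f p))"
proof -
  have "(\<Sum>p\<in>T. gram_kernel S B v q p * f p) = (\<Sum>s\<in>S. \<Sum>p\<in>T. \<Sum>t\<in>S. v s q * B s t * (v t p * f p))"
    unfolding gram_kernel_def sum_distrib_right mult.assoc by (rule sum.swap)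
  also have "\<dots> = (\<Sum>s\<in>S. \<Sum>t\<in>S. v s q * B s t * (\<Sum>p\<in>T. v t p * f p))"
    unfolding sum_distrib_left by (intro sum.cong refl sum.swap)
  finally show ?thesis .
qed

lemma sum_gram_kernel_right:
  "(\<Sum>q\<in>T. f q * gram_kernel S B v q p) = (\<Sum>t\<in>S. \<Sum>s\<in>S. (\<Sum>q\<in>T. f q * v s q) * B s t * v t p)"
proof -
  have "(\<Sum>q\<in>T. f q * gram_kernel S B v q p) = (\<Sum>q\<in>T. \<Sum>t\<in>S. \<Sum>s\<in>S. f q * v s q * B s t * v t p)"
    unfolding gram_kernel_def sum_distrib_left mult.assoc by (intro sum.cong refl sum.swap)
  also have "\<dots> = (\<Sum>t\<in>S. \<Sum>q\<in>T. \<Sum>s\<in>S. f q * v s q * B s t * v t p)"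
    by (rule sum.swap)
  also have "\<dots> = (\<Sum>t\<in>S. \<Sum>s\<in>S. (\<Sum>q\<in>T. f q * v s q) * B s t * v t p)"
    unfolding sum_distrib_right by (intro sum.cong refl sum.swap)
  finally show ?thesis .
qed

lemma gram_kernel_reproducing:
  assumes "finite S"
    and inverse: "is_inverse_on S G B"
    and gram: "\<And>s t. s \<in> S \<Longrightarrow> t \<in> S \<Longrightarrow> (\<Sum>p\<in>T. v s p * v t p) = G s t"
    and f: "f \<in> complex_fun.span (v ` S)"
  shows "(\<Sum>p\<in>T. gram_kernel S B v q p * f p) = f q"
    and "(\<Sum>q\<in>T. f q * gram_kernel S B v q p) = f p"
proof -
  let ?V = "{f. (\<Sum>p\<in>T. gram_kernel S B v q p * f p) = f q}"
  have "v u \<in> ?V" if u: "u \<in> S" for u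
  proof -
    have "(\<Sum>p\<in>T. gram_kernel S B v q p * v u p) = (\<Sum>s\<in>S. v s q * (\<Sum>t\<in>S. B s t * G t u))"
      using u by (simp add: sum_gram_kernel_left gram sum_distrib_left mult.assoc)
    then show ?thesis
      using inverse u assms(1) by (simp add: is_inverse_on_def sum_of_bool_delta)
  qed
  moreover have "complex_fun.subspace ?V"
    by (auto intro!: complex_fun.subspaceI
        simp: distrib_left sum.distrib mult.left_commute simp flip: sum_distrib_left)
  ultimately show "(\<Sum>p\<in>T. gram_kernel S B v q p * f p) = f q"
    using complex_fun.span_minimal[of "v ` S" ?V] f by blast
next
  let ?V = "{f. (\<Sum>q\<in>T. f q * gram_kernel S B v q p) = f p}"
  have "v u \<in> ?V" if u: "u \<in> S" for u
  proof -
    have "(\<Sum>q\<in>T. v u q * gram_kernel S B v q p) = (\<Sum>t\<in>S. (\<Sum>s\<in>S. G u s * B s t) * v t p)"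
      using u by (simp add: sum_gram_kernel_right gram sum_distrib_right)
    then show ?thesis
      using inverse u assms(1) by (simp add: is_inverse_on_def sum_of_bool_delta)
  qed
  moreover have "complex_fun.subspace ?V"
    by (auto intro!: complex_fun.subspaceI
        simp: distrib_right sum.distrib mult.assoc simp flip: sum_distrib_left)
  ultimately show "(\<Sum>q\<in>T. f q * gram_kernel S B v q p) = f p"
    using complex_fun.span_minimal[of "v ` S" ?V] f by blast
qed

section \<open>Permutations without long decreasing subsequences\<close>

lemma ex_decreasing_sequence_iff:
  fixes \<sigma> :: "nat \<Rightarrow> 'a::preorder" and A :: "nat set"
  assumes "finite A"
  shows "(\<exists>s. s ` {1..m} \<subseteq> A \<and> strict_mono_on {1..m} s \<and> strict_antimono_on {1..m} (\<sigma> \<circ> s)) \<longleftrightarrow>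
    (\<exists>C\<subseteq>A. card C = m \<and> strict_antimono_on C \<sigma>)" (is "(\<exists>s. ?seq s) \<longleftrightarrow> (\<exists>C\<subseteq>A. ?chain C)")
proof
  assume "\<exists>s. ?seq s"
  then obtain s where s: "?seq s" ..
  have "card (s ` {1..m}) = m"
    using s by (simp add: card_image strict_mono_on_imp_inj_on)
  moreover have "strict_antimono_on (s ` {1..m}) \<sigma>"
    using s by (auto simp: monotone_on_def strict_mono_on_less)
  ultimately show "\<exists>C\<subseteq>A. ?chain C" using s by blast
next
  assume "\<exists>C\<subseteq>A. ?chain C"
  then obtain C where C: "C \<subseteq> A" "card C = m" "strict_antimono_on C \<sigma>" by blast
  then obtain h where "bij_betw h {..<m} C" and h_mono: "strict_mono_on {..<m} h"
    using ex_bij_betw_strict_mono_card assms finite_subset by metis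
  then have h: "h k \<in> C" if "k < m" for k
    using that by (auto simp: bij_betw_def)
  have "?seq (\<lambda>k. h (k - 1))"
    using h subsetD[OF C(1) h] monotone_onD[OF C(3)] monotone_onD[OF h_mono]
    by (auto intro!: monotone_onI)
  then show "\<exists>s. ?seq s" by blast
qed

lemma perms_no_decreasing_iff:
  "\<sigma> \<in> perms_no_decreasing N n \<longleftrightarrow>
     \<sigma> permutes {1..n} \<and> (\<forall>C\<subseteq>{1..n}. strict_antimono_on C \<sigma> \<longrightarrow> card C \<le> N)"
proof -
  have "(\<exists>C\<subseteq>{1..n}. card C = N + 1 \<and> strict_antimono_on C \<sigma>) \<longleftrightarrow>
      (\<exists>C\<subseteq>{1..n}. N < card C \<and> strict_antimono_on C \<sigma>)"
  proof
    assume "\<exists>C\<subseteq>{1..n}. N < card C \<and> strict_antimono_on C \<sigma>"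
    then obtain C where C: "C \<subseteq> {1..n}" "N + 1 \<le> card C" "strict_antimono_on C \<sigma>" by auto
    obtain D where "D \<subseteq> C" "card D = N + 1"
      using obtain_subset_with_card_n[OF C(2)] by metis
    with C show "\<exists>C\<subseteq>{1..n}. card C = N + 1 \<and> strict_antimono_on C \<sigma>"
      using monotone_on_subset[OF C(3)] by (intro exI[of _ D]) simp
  qed auto
  then show ?thesis
    unfolding perms_no_decreasing_def mem_Collect_eq
      ex_decreasing_sequence_iff[OF finite_atLeastAtMost]
    by (auto simp flip: not_less)
qed

lemma perms_no_decreasing_permutes:
  "\<sigma> \<in> perms_no_decreasing N n \<Longrightarrow> \<sigma> permutes {1..n}"
  by (simp add: perms_no_decreasing_def)

lemma finite_perms_no_decreasing: "finite (perms_no_decreasing N n)"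
  by (rule finite_subset[OF _ finite_permutations[of "{1..n}"]])
     (auto dest: perms_no_decreasing_permutes)

definition decreasing_chains_ending_at ::
  "'a::linorder set \<Rightarrow> ('a \<Rightarrow> 'b::linorder) \<Rightarrow> 'a \<Rightarrow> 'a set set" where
  "decreasing_chains_ending_at A \<sigma> k =
     {C. C \<subseteq> A \<inter> {..k} \<and> k \<in> C \<and> strict_antimono_on C \<sigma>}"

definition longest_decreasing :: "'a::linorder set \<Rightarrow> ('a \<Rightarrow> 'b::linorder) \<Rightarrow> 'a \<Rightarrow> nat" where
  "longest_decreasing A \<sigma> k = Max (card ` decreasing_chains_ending_at A \<sigma> k)"

lemma finite_decreasing_chains_ending_at:
  "finite A \<Longrightarrow> finite (decreasing_chains_ending_at A \<sigma> k)"
  by (rule finite_subset[of _ "Pow A"]) (auto simp: decreasing_chains_ending_at_def)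

lemma longest_decreasing_attained:
  assumes "finite A" and "k \<in> A"
  obtains C where "C \<in> decreasing_chains_ending_at A \<sigma> k" and "card C = longest_decreasing A \<sigma> k"
proof -
  have "{k} \<in> decreasing_chains_ending_at A \<sigma> k"
    using assms(2) by (auto simp: decreasing_chains_ending_at_def monotone_on_def)
  then have "longest_decreasing A \<sigma> k \<in> card ` decreasing_chains_ending_at A \<sigma> k"
    unfolding longest_decreasing_def
    by (intro Max_in finite_imageI finite_decreasing_chains_ending_at assms(1)) blast
  then show thesis using that by auto
qed

lemma longest_decreasing_less:
  assumes "finite A" and "k \<in> A" and "l \<in> A" and "k < l" and "\<sigma> l < \<sigma> k"
  shows "longest_decreasing A \<sigma> k < longest_decreasing A \<sigma> l"
proof -
  obtain C where C: "C \<in> decreasing_chains_ending_at A \<sigma> k"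
    and card_C: "card C = longest_decreasing A \<sigma> k"
    using longest_decreasing_attained[OF assms(1,2)] by blast
  have "\<sigma> k \<le> \<sigma> a" if "a \<in> C" for a
    using C that by (cases "a = k") (fastforce simp: decreasing_chains_ending_at_def monotone_on_def)+
  then have "insert l C \<in> decreasing_chains_ending_at A \<sigma> l"
    using C assms by (fastforce simp: decreasing_chains_ending_at_def monotone_on_def)
  then have "card (insert l C) \<le> longest_decreasing A \<sigma> l"
    unfolding longest_decreasing_def
    by (intro Max_ge finite_imageI finite_decreasing_chains_ending_at assms(1) imageI)
  moreover have "l \<notin> C" and "finite C"
    using C assms(1,4) finite_subset by (auto simp: decreasing_chains_ending_at_def)
  ultimately show ?thesis using card_C by simp
qed

lemma perms_no_decreasing_colouring:
  assumes "\<sigma> \<in> perms_no_decreasing N n"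
  obtains c :: "nat \<Rightarrow> nat" where "c ` {1..n} \<subseteq> {1..N}"
    and "\<And>k l. k \<in> {1..n} \<Longrightarrow> l \<in> {1..n} \<Longrightarrow> k < l \<Longrightarrow> c k = c l \<Longrightarrow> \<sigma> k < \<sigma> l"
proof (rule that[of "longest_decreasing {1..n} \<sigma>"])
  show "longest_decreasing {1..n} \<sigma> ` {1..n} \<subseteq> {1..N}"
  proof (rule image_subsetI)
    fix k assume "k \<in> {1..n}"
    then obtain C where "C \<in> decreasing_chains_ending_at {1..n} \<sigma> k"
      and card_C: "card C = longest_decreasing {1..n} \<sigma> k"
      using longest_decreasing_attained by blast
    then have C: "C \<subseteq> {1..n}" "k \<in> C" "strict_antimono_on C \<sigma>"
      by (auto simp: decreasing_chains_ending_at_def)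
    then have "card C \<le> N"
      using assms by (simp add: perms_no_decreasing_iff)
    moreover have "card C \<noteq> 0"
      using C(2) finite_subset[OF C(1)] by auto
    ultimately show "longest_decreasing {1..n} \<sigma> k \<in> {1..N}"
      using card_C by simp
  qed
next
  fix k l assume "k \<in> {1..n}" "l \<in> {1..n}" "k < l"
    and "longest_decreasing {1..n} \<sigma> k = longest_decreasing {1..n} \<sigma> l"
  then have "\<not> \<sigma> l < \<sigma> k"
    using longest_decreasing_less[of "{1..n}" k l \<sigma>] by auto
  moreover have "\<sigma> k \<noteq> \<sigma> l"
    using \<open>k < l\<close> permutes_inj[OF perms_no_decreasing_permutes[OF assms]] by (auto dest: injD)
  ultimately show "\<sigma> k < \<sigma> l" by simp
qed

lemma first_moved_point:
  fixes \<pi> :: "'a::wellorder \<Rightarrow> 'a"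
  assumes "inj \<pi>" and "\<pi> \<noteq> id"
  obtains k where "k < \<pi> k" and "\<And>l. l < k \<Longrightarrow> \<pi> l = l"
proof -
  define k where "k = (LEAST k. \<pi> k \<noteq> k)"
  from \<open>\<pi> \<noteq> id\<close> have "\<exists>k. \<pi> k \<noteq> k" by auto
  then have k: "\<pi> k \<noteq> k" unfolding k_def by (rule LeastI_ex)
  have below: "\<pi> l = l" if "l < k" for l
    using that not_less_Least unfolding k_def by blast
  have "\<not> \<pi> k < k"
    using below[of "\<pi> k"] k \<open>inj \<pi>\<close> by (auto dest: injD)
  with k below show thesis by (intro that[of k]) auto
qed

lemma wfp_on_less_fun:
  assumes "finite A"
  shows "wfp_on A less_fun" and "wfp_on A (\<lambda>f g. less_fun g f)"
  using assms by (auto intro!: strict_partial_order_wfp_on_finite_set transp_onI asymp_onI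
      intro: less_fun_trans dest: less_fun_asym)

section \<open>Permutation tensors\<close>

definition tuples :: "nat \<Rightarrow> (nat \<Rightarrow> 'a) set" where
  "tuples n = {1..n} \<rightarrow>\<^sub>E UNIV"

text \<open>Operators on the \<open>n\<close>-th tensor power of \<open>\<complex>\<^sup>N\<close> are functions on pairs (row index, column index)
  of tuples.\<close>

definition perm_tensor :: "nat \<Rightarrow> (nat \<Rightarrow> nat) \<Rightarrow> (nat \<Rightarrow> 'a) \<times> (nat \<Rightarrow> 'a) \<Rightarrow> complex" where
  "perm_tensor n \<sigma> p = of_bool (\<forall>k\<in>{1..n}. fst p k = snd p (\<sigma> k))"

lemma finite_tuples: "finite (tuples n :: (nat \<Rightarrow> 'a::finite) set)"
  unfolding tuples_def by (rule finite_PiE) auto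

lemma restrict_in_tuples: "restrict i {1..n} \<in> tuples n"
  by (simp add: tuples_def)

lemma tuples_eqI:
  assumes "i \<in> tuples n" and "j \<in> tuples n" and "\<And>k. k \<in> {1..n} \<Longrightarrow> i k = j k"
  shows "i = j"
  using assms unfolding tuples_def by (rule PiE_ext)

lemma tuples_comp:
  assumes "i \<in> tuples n" and "\<pi> permutes {1..n}"
  shows "i \<circ> \<pi> \<in> tuples n"
  using assms permutes_not_in[OF assms(2)] by (auto simp: tuples_def PiE_def extensional_def)

lemma comp_permutes_eq_iff:
  assumes "\<pi> permutes A"
  shows "i \<circ> \<pi> = j \<longleftrightarrow> i = j \<circ> inv \<pi>"
  using permutes_inv_o[OF assms] by (metis comp_assoc comp_id)

lemma sum_tuples_comp:
  fixes f :: "(nat \<Rightarrow> 'a) \<Rightarrow> 'b::comm_monoid_add"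
  assumes "\<pi> permutes {1..n}"
  shows "(\<Sum>i\<in>tuples n. f (i \<circ> \<pi>)) = (\<Sum>i\<in>tuples n. f i)"
  using assms permutes_inv[OF assms] permutes_inv_o[OF assms]
  by (intro sum.reindex_bij_witness[of _ "\<lambda>i. i \<circ> inv \<pi>" "\<lambda>i. i \<circ> \<pi>"])
     (auto simp: comp_assoc intro: tuples_comp)

lemma perm_tensor_on_tuples:
  assumes "i \<in> tuples n" and "i' \<in> tuples n" and "\<sigma> permutes {1..n}"
  shows "perm_tensor n \<sigma> (i, i') = of_bool (i = i' \<circ> \<sigma>)"
proof -
  have "(\<forall>k\<in>{1..n}. i k = i' (\<sigma> k)) \<longleftrightarrow> i = i' \<circ> \<sigma>"
    using tuples_eqI[OF assms(1) tuples_comp[OF assms(2,3)]] by auto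
  then show ?thesis by (simp add: perm_tensor_def)
qed

lemma perm_tensor_restrict:
  assumes "\<sigma> permutes {1..n}"
  shows "perm_tensor n \<sigma> (restrict i {1..n}, restrict i' {1..n}) = perm_tensor n \<sigma> (i, i')"
  using permutes_in_image[OF assms] by (simp add: perm_tensor_def)

lemma perm_tensor_comp:
  assumes "\<pi> permutes {1..n}"
  shows "perm_tensor n \<sigma> (i \<circ> \<pi>, i') = perm_tensor n (\<sigma> \<circ> inv \<pi>) (i, i')"
proof -
  have "(\<forall>k\<in>{1..n}. i (\<pi> k) = i' (\<sigma> k)) \<longleftrightarrow> (\<forall>k\<in>\<pi> ` {1..n}. i k = i' (\<sigma> (inv \<pi> k)))"
    by (simp add: permutes_inverses[OF assms])
  then show ?thesis
    unfolding permutes_image[OF assms] by (simp add: perm_tensor_def)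
qed

lemma sum_perm_tensor_fst:
  fixes f :: "(nat \<Rightarrow> 'a::finite) \<Rightarrow> complex"
  assumes "\<sigma> permutes {1..n}" and "i' \<in> tuples n"
  shows "(\<Sum>i\<in>tuples n. perm_tensor n \<sigma> (i, i') * f i) = f (i' \<circ> \<sigma>)"
  using assms tuples_comp[OF assms(2,1)]
  by (simp add: perm_tensor_on_tuples sum_of_bool_delta finite_tuples)

lemma sum_perm_tensor_snd:
  fixes f :: "(nat \<Rightarrow> 'a::finite) \<Rightarrow> complex"
  assumes "\<sigma> permutes {1..n}" and "i \<in> tuples n"
  shows "(\<Sum>i'\<in>tuples n. perm_tensor n \<sigma> (i, i') * f i') = f (i \<circ> inv \<sigma>)"
proof -
  have "perm_tensor n \<sigma> (i, i') = of_bool (i' = i \<circ> inv \<sigma>)" if "i' \<in> tuples n" for i'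
    using perm_tensor_on_tuples[OF assms(2) that assms(1)] comp_permutes_eq_iff[OF assms(1), of i' i]
    by (simp only: eq_commute)
  then show ?thesis
    using tuples_comp[OF assms(2) permutes_inv[OF assms(1)]]
    by (simp add: sum_of_bool_delta finite_tuples)
qed

lemma sum_perm_tensor:
  fixes f :: "(nat \<Rightarrow> 'a::finite) \<times> (nat \<Rightarrow> 'a) \<Rightarrow> complex"
  assumes "\<sigma> permutes {1..n}"
  shows "(\<Sum>p\<in>tuples n \<times> tuples n. perm_tensor n \<sigma> p * f p) = (\<Sum>i\<in>tuples n. f (i \<circ> \<sigma>, i))"
proof -
  have "(\<Sum>p\<in>tuples n \<times> tuples n. perm_tensor n \<sigma> p * f p)
      = (\<Sum>i'\<in>tuples n. \<Sum>i\<in>tuples n. perm_tensor n \<sigma> (i, i') * f (i, i'))"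
    by (subst sum.swap) (simp add: sum.cartesian_product split_def)
  also have "\<dots> = (\<Sum>i\<in>tuples n. f (i \<circ> \<sigma>, i))"
    by (intro sum.cong refl sum_perm_tensor_fst assms)
  finally show ?thesis .
qed

lemma antisymmetrizer_zero:
  fixes p :: "(nat \<Rightarrow> 'N::finite) \<times> (nat \<Rightarrow> 'N)"
  assumes "C \<subseteq> {1..n}" and "CARD('N) < card C"
  shows "(\<Sum>\<pi> | \<pi> permutes C. of_int (sign \<pi>) * perm_tensor n (\<sigma> \<circ> \<pi>) p) = 0"
proof -
  obtain i i' where p: "p = (i, i')" by fastforce
  have "\<not> inj_on i C"
    using card_inj_on_le[of i C UNIV] assms(2) by auto
  then obtain a b where ab: "a \<in> C" "b \<in> C" "a \<noteq> b" "i a = i b"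
    by (auto simp: inj_on_def)
  define t where "t = Transposition.transpose a b"
  have t: "t permutes C"
    unfolding t_def using ab by (intro permutes_swap_id)
  have i_t: "i \<circ> t = i"
    using ab(4) by (auto simp: t_def Transposition.transpose_def)
  let ?f = "\<lambda>\<pi>. of_int (sign \<pi>) * perm_tensor n (\<sigma> \<circ> \<pi>) p"
  have "(\<Sum>\<pi> | \<pi> permutes C. ?f \<pi>) = (\<Sum>\<pi> | \<pi> permutes C. ?f (\<pi> \<circ> t))"
    by (rule sum_permutations_compose_right[OF t])
  also have "\<dots> = (\<Sum>\<pi> | \<pi> permutes C. - ?f \<pi>)"
  proof (rule sum.cong[OF refl])
    fix \<pi> assume "\<pi> \<in> {\<pi>. \<pi> permutes C}"
    then have "sign (\<pi> \<circ> t) = - sign \<pi>"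
      using t ab(3) finite_subset[OF assms(1)]
      by (subst sign_compose) (auto simp: permutation_permutes t_def sign_swap_id)
    moreover have "perm_tensor n (\<sigma> \<circ> (\<pi> \<circ> t)) p = perm_tensor n (\<sigma> \<circ> \<pi>) p"
      using perm_tensor_comp[OF permutes_subset[OF t assms(1)], of "\<sigma> \<circ> \<pi>" i i']
      by (simp add: p i_t comp_assoc) (simp add: t_def)
    ultimately show "?f (\<pi> \<circ> t) = - ?f \<pi>" by simp
  qed
  finally show ?thesis by (simp add: sum_negf)
qed

lemma less_fun_comp_if_antimono:
  fixes \<rho> :: "nat \<Rightarrow> nat"
  assumes "strict_antimono_on C \<rho>" and "\<pi> permutes C" and "\<pi> \<noteq> id"
  shows "less_fun (\<rho> \<circ> \<pi>) \<rho>"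
proof -
  obtain k where k: "k < \<pi> k" "\<And>l. l < k \<Longrightarrow> \<pi> l = l"
    using first_moved_point[OF permutes_inj[OF assms(2)] assms(3)] by blast
  then have "k \<in> C" and "\<pi> k \<in> C"
    using assms(2) by (metis less_irrefl permutes_not_in permutes_in_image)+
  with k assms(1) show ?thesis
    by (intro less_funI exI[of _ k]) (auto simp: monotone_on_def)
qed

text \<open>Straightening: on a decreasing subsequence of length greater than \<open>N\<close>, the antisymmetrizer
  rewrites the tensor of \<open>\<rho>\<close> in terms of lexicographically smaller permutations.\<close>

lemma perm_tensor_straighten:
  fixes p :: "(nat \<Rightarrow> 'N::finite) \<times> (nat \<Rightarrow> 'N)"
  assumes "C \<subseteq> {1..n}" and "CARD('N) < card C"
  shows "perm_tensor n \<rho> p =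
    (\<Sum>\<pi>\<in>{\<pi>. \<pi> permutes C} - {id}. - of_int (sign \<pi>) * perm_tensor n (\<rho> \<circ> \<pi>) p)"
proof -
  let ?f = "\<lambda>\<pi>. of_int (sign \<pi>) * perm_tensor n (\<rho> \<circ> \<pi>) p"
  have "perm_tensor n \<rho> p + (\<Sum>\<pi>\<in>{\<pi>. \<pi> permutes C} - {id}. ?f \<pi>) = (\<Sum>\<pi> | \<pi> permutes C. ?f \<pi>)"
    using finite_subset[OF assms(1)]
    by (subst (2) sum.remove[of _ id]) (auto simp: finite_permutations permutes_id sign_id)
  also have "\<dots> = 0"
    by (rule antisymmetrizer_zero[OF assms])
  finally show ?thesis
    by (simp add: sum_negf eq_neg_iff_add_eq_0)
qed

lemma perm_tensor_in_span:
  assumes "\<rho> permutes {1..n}"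
  shows "(perm_tensor n \<rho> :: (nat \<Rightarrow> 'N::finite) \<times> (nat \<Rightarrow> 'N) \<Rightarrow> complex) \<in>
    complex_fun.span (perm_tensor n ` perms_no_decreasing CARD('N) n)"
proof -
  let ?v = "perm_tensor n :: _ \<Rightarrow> (nat \<Rightarrow> 'N) \<times> (nat \<Rightarrow> 'N) \<Rightarrow> complex"
  let ?V = "complex_fun.span (?v ` perms_no_decreasing CARD('N) n)"
  have "wfp_on {\<rho>. \<rho> permutes {1..n}} less_fun"
    by (intro wfp_on_less_fun finite_permutations) simp
  then show ?thesis using assms
  proof (induction \<rho> rule: wfp_on_induct)
    case in_set
    then show ?case using assms by simp
  next
    case (less \<rho>)
    show ?case
    proof (cases "\<rho> \<in> perms_no_decreasing CARD('N) n")
      case True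
      then show ?thesis by (intro complex_fun.span_base imageI)
    next
      case False
      then obtain C where C: "C \<subseteq> {1..n}" "CARD('N) < card C" "strict_antimono_on C \<rho>"
        using less.prems by (auto simp: perms_no_decreasing_iff not_le)
      have "?v (\<rho> \<circ> \<pi>) \<in> ?V" if "\<pi> \<in> {\<pi>. \<pi> permutes C} - {id}" for \<pi>
      proof -
        have "\<rho> \<circ> \<pi> permutes {1..n}"
          using that C(1) less.prems by (auto intro: permutes_compose permutes_subset)
        moreover have "less_fun (\<rho> \<circ> \<pi>) \<rho>"
          using that C(3) by (auto intro: less_fun_comp_if_antimono)
        ultimately show ?thesis using less.IH by simp
      qed
      then have "(\<lambda>p. \<Sum>\<pi>\<in>{\<pi>. \<pi> permutes C} - {id}. - of_int (sign \<pi>) * ?v (\<rho> \<circ> \<pi>) p) \<in> ?V"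
        by (intro subspace_linear_combination complex_fun.subspace_span)
      then show ?thesis
        by (simp only: perm_tensor_straighten[OF C(1,2), symmetric])
    qed
  qed
qed

lemma less_fun_if_same_colour_classes:
  fixes \<sigma> \<tau> :: "nat \<Rightarrow> nat"
  assumes \<sigma>: "\<sigma> permutes A" and \<tau>: "\<tau> permutes A" and "\<tau> \<noteq> \<sigma>"
    and increasing: "\<And>k l. k \<in> A \<Longrightarrow> l \<in> A \<Longrightarrow> k < l \<Longrightarrow> c k = c l \<Longrightarrow> \<sigma> k < \<sigma> l"
    and same_colour: "\<And>k. k \<in> A \<Longrightarrow> c (inv \<sigma> (\<tau> k)) = c k"
  shows "less_fun \<sigma> \<tau>"
proof -
  define \<pi> where "\<pi> = inv \<sigma> \<circ> \<tau>"
  have \<pi>: "\<pi> permutes A"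
    unfolding \<pi>_def using \<tau> permutes_inv[OF \<sigma>] by (rule permutes_compose)
  have \<tau>_eq: "\<tau> k = \<sigma> (\<pi> k)" for k
    by (simp add: \<pi>_def permutes_inverses[OF \<sigma>])
  then have "\<pi> \<noteq> id" using \<open>\<tau> \<noteq> \<sigma>\<close> by auto
  then obtain k where k: "k < \<pi> k" "\<And>l. l < k \<Longrightarrow> \<pi> l = l"
    using first_moved_point[OF permutes_inj[OF \<pi>]] by blast
  then have "k \<in> A" and "\<pi> k \<in> A"
    using \<pi> by (metis less_irrefl permutes_not_in permutes_in_image)+
  moreover from this have "c (\<pi> k) = c k"
    using same_colour[of k] by (simp add: \<pi>_def)
  ultimately have "\<sigma> k < \<tau> k"
    using increasing[of k "\<pi> k"] k(1) by (simp add: \<tau>_eq)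
  then show ?thesis
    using \<tau>_eq k(2) by (intro less_funI exI[of _ k]) simp
qed

text \<open>The tuples are an \<open>N\<close>-colouring of \<open>{1..n}\<close> with \<open>\<sigma>\<close> increasing on every colour class and its
  transport along \<open>\<sigma>\<close>, so only permutations with the same image of each class have a nonzero entry.\<close>

lemma perm_tensor_separating_tuples:
  assumes "\<sigma> \<in> perms_no_decreasing CARD('N::finite) n"
  obtains p :: "(nat \<Rightarrow> 'N::finite) \<times> (nat \<Rightarrow> 'N)" where "p \<in> tuples n \<times> tuples n"
    and "perm_tensor n \<sigma> p = 1"
    and "\<And>\<tau>. \<tau> permutes {1..n} \<Longrightarrow> \<tau> \<noteq> \<sigma> \<Longrightarrow> perm_tensor n \<tau> p \<noteq> 0 \<Longrightarrow> less_fun \<sigma> \<tau>"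
proof -
  note \<sigma> = perms_no_decreasing_permutes[OF assms]
  obtain c :: "nat \<Rightarrow> nat" where c: "c ` {1..n} \<subseteq> {1..CARD('N)}"
    and increasing: "\<And>k l. k \<in> {1..n} \<Longrightarrow> l \<in> {1..n} \<Longrightarrow> k < l \<Longrightarrow> c k = c l \<Longrightarrow> \<sigma> k < \<sigma> l"
    using perms_no_decreasing_colouring[OF assms] by blast
  obtain h :: "nat \<Rightarrow> 'N" where "bij_betw h {1..CARD('N)} UNIV"
    using ex_bij_betw_nat_finite_1[OF finite_class.finite_UNIV] by blast
  then have inj_h: "inj_on h {1..CARD('N)}" by (rule bij_betw_imp_inj_on)
  define i where "i = (\<lambda>k\<in>{1..n}. h (c k))"
  have i: "i \<in> tuples n" unfolding i_def by (rule restrict_in_tuples)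
  have "less_fun \<sigma> \<tau>"
    if \<tau>: "\<tau> permutes {1..n}" "\<tau> \<noteq> \<sigma>" "perm_tensor n \<tau> (i, i \<circ> inv \<sigma>) \<noteq> 0" for \<tau>
  proof (rule less_fun_if_same_colour_classes[OF \<sigma> \<tau>(1,2) increasing])
    fix k assume k: "k \<in> {1..n}"
    let ?l = "inv \<sigma> (\<tau> k)"
    have l: "?l \<in> {1..n}"
      using k permutes_in_image[OF \<tau>(1)] permutes_in_image[OF permutes_inv[OF \<sigma>]] by simp
    have "i k = i ?l"
      using \<tau>(3) k by (simp add: perm_tensor_def)
    then have "h (c ?l) = h (c k)"
      using k l by (simp add: i_def)
    then show "c ?l = c k"
      using c k l by (intro inj_onD[OF inj_h]) blast+
  qed
  moreover have "(i, i \<circ> inv \<sigma>) \<in> tuples n \<times> tuples n"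
    using i tuples_comp[OF i permutes_inv[OF \<sigma>]] by simp
  moreover have "perm_tensor n \<sigma> (i, i \<circ> inv \<sigma>) = 1"
    by (simp add: perm_tensor_def permutes_inverses[OF \<sigma>])
  ultimately show thesis by (intro that)
qed

lemma lin_indep_on_perm_tensor:
  "lin_indep_on (tuples n \<times> tuples n :: ((nat \<Rightarrow> 'N::finite) \<times> (nat \<Rightarrow> 'N)) set) (perm_tensor n)
     (perms_no_decreasing CARD('N) n)" (is "lin_indep_on ?T _ ?S")
  unfolding lin_indep_on_def
proof (intro allI impI ballI)
  fix x \<sigma>
  assume zero: "\<forall>p\<in>?T. (\<Sum>\<tau>\<in>?S. x \<tau> * perm_tensor n \<tau> p) = 0" and "\<sigma> \<in> ?S"
  have "wfp_on ?S (\<lambda>\<tau> \<sigma>. less_fun \<sigma> \<tau>)"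
    by (rule wfp_on_less_fun[OF finite_perms_no_decreasing])
  then show "x \<sigma> = 0" using \<open>\<sigma> \<in> ?S\<close>
  proof (induction \<sigma> rule: wfp_on_induct)
    case in_set
    then show ?case using \<open>\<sigma> \<in> ?S\<close> by simp
  next
    case (less \<sigma>)
    obtain p :: "(nat \<Rightarrow> 'N) \<times> (nat \<Rightarrow> 'N)" where p: "p \<in> ?T" "perm_tensor n \<sigma> p = 1"
      and larger: "\<And>\<tau>. \<tau> permutes {1..n} \<Longrightarrow> \<tau> \<noteq> \<sigma> \<Longrightarrow> perm_tensor n \<tau> p \<noteq> 0 \<Longrightarrow> less_fun \<sigma> \<tau>"
      using perm_tensor_separating_tuples[OF less.prems] by blast
    have "(\<Sum>\<tau>\<in>?S - {\<sigma>}. x \<tau> * perm_tensor n \<tau> p) = 0"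
      using less.IH larger perms_no_decreasing_permutes by (intro sum.neutral) fastforce
    then show ?case
      using bspec[OF zero p(1)] p(2)
        sum.remove[OF finite_perms_no_decreasing less.prems, of "\<lambda>\<tau>. x \<tau> * perm_tensor n \<tau> p"]
      by simp
  qed
qed

section \<open>The Gram matrix of the permutation tensors\<close>

lemma card_PiE_factoring_through:
  assumes "finite A"
  shows "card {f \<in> A \<rightarrow>\<^sub>E B. \<forall>x\<in>A. \<forall>y\<in>A. q x = q y \<longrightarrow> f x = f y} = card B ^ card (q ` A)"
proof -
  let ?F = "{f \<in> A \<rightarrow>\<^sub>E B. \<forall>x\<in>A. \<forall>y\<in>A. q x = q y \<longrightarrow> f x = f y}"
  have "bij_betw (\<lambda>g. \<lambda>x\<in>A. g (q x)) (q ` A \<rightarrow>\<^sub>E B) ?F"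
  proof (rule bij_betw_byWitness[where f' = "\<lambda>f. \<lambda>y\<in>q ` A. f (inv_into A q y)"])
    show "\<forall>g\<in>q ` A \<rightarrow>\<^sub>E B. (\<lambda>y\<in>q ` A. (\<lambda>x\<in>A. g (q x)) (inv_into A q y)) = g"
      by (fastforce simp: fun_eq_iff inv_into_into f_inv_into_f PiE_def extensional_def)
    show "\<forall>f\<in>?F. (\<lambda>x\<in>A. (\<lambda>y\<in>q ` A. f (inv_into A q y)) (q x)) = f"
    proof (intro ballI extensionalityI[of _ A])
      fix f x assume f: "f \<in> ?F" and x: "x \<in> A"
      have "inv_into A q (q x) \<in> A" and "q (inv_into A q (q x)) = q x"
        using x by (auto intro: inv_into_into f_inv_into_f)
      with f x have "f (inv_into A q (q x)) = f x" by blast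
      with x show "(\<lambda>x\<in>A. (\<lambda>y\<in>q ` A. f (inv_into A q y)) (q x)) x = f x" by simp
    qed (auto simp: PiE_def)
  qed (auto simp: inv_into_into)
  then have "card ?F = card (q ` A \<rightarrow>\<^sub>E B)"
    by (simp add: bij_betw_same_card)
  then show ?thesis using assms by (simp add: card_PiE)
qed

lemma comp_eq_iff_constant_on_orbits:
  assumes "\<rho> permutes {1..n}" and "i \<in> tuples n"
  shows "i \<circ> \<rho> = i \<longleftrightarrow> (\<forall>k\<in>{1..n}. \<forall>l\<in>{1..n}. orbit \<rho> k = orbit \<rho> l \<longrightarrow> i k = i l)"
proof
  have \<rho>: "permutation \<rho>"
    using assms(1) by (auto simp: permutation_permutes)
  show "\<forall>k\<in>{1..n}. \<forall>l\<in>{1..n}. orbit \<rho> k = orbit \<rho> l \<longrightarrow> i k = i l" if "i \<circ> \<rho> = i"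
  proof (intro ballI impI)
    fix k l assume "orbit \<rho> k = orbit \<rho> l"
    then have "k \<in> orbit \<rho> l"
      using permutation_self_in_orbit[OF \<rho>, of k] by simp
    then show "i k = i l"
      by induction (use that in \<open>auto simp: fun_eq_iff\<close>)
  qed
  show "i \<circ> \<rho> = i" if const: "\<forall>k\<in>{1..n}. \<forall>l\<in>{1..n}. orbit \<rho> k = orbit \<rho> l \<longrightarrow> i k = i l"
  proof (rule tuples_eqI[OF tuples_comp[OF assms(2,1)] assms(2)])
    fix k assume "k \<in> {1..n}"
    then show "(i \<circ> \<rho>) k = i k"
      using const[rule_format, of "\<rho> k" k] permutes_in_image[OF assms(1)] permutation_orbit_step[OF \<rho>]
      by auto
  qed
qed

lemma card_tuples_fixed_by:
  assumes "\<rho> permutes {1..n}"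
  shows "card {i \<in> tuples n. i \<circ> \<rho> = (i :: nat \<Rightarrow> 'N::finite)} = CARD('N) ^ num_cycles n \<rho>"
proof -
  have "{i \<in> tuples n. i \<circ> \<rho> = (i :: nat \<Rightarrow> 'N)} =
      {i \<in> tuples n. \<forall>k\<in>{1..n}. \<forall>l\<in>{1..n}. orbit \<rho> k = orbit \<rho> l \<longrightarrow> i k = i l}"
    using comp_eq_iff_constant_on_orbits[OF assms] by blast
  then show ?thesis
    by (simp only: tuples_def card_PiE_factoring_through finite_atLeastAtMost num_cycles_def)
qed

lemma perm_tensor_gram:
  assumes "\<sigma> permutes {1..n}" and "\<tau> permutes {1..n}"
  shows "(\<Sum>p\<in>tuples n \<times> tuples n. perm_tensor n \<sigma> p *
      perm_tensor n \<tau> (p :: (nat \<Rightarrow> 'N::finite) \<times> (nat \<Rightarrow> 'N))) = gram_matrix CARD('N) n \<sigma> \<tau>"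
proof -
  have "(\<Sum>p\<in>tuples n \<times> tuples n. perm_tensor n \<sigma> p *
      perm_tensor n \<tau> (p :: (nat \<Rightarrow> 'N) \<times> (nat \<Rightarrow> 'N))) =
      (\<Sum>i\<in>tuples n. perm_tensor n \<tau> (i \<circ> \<sigma>, i :: nat \<Rightarrow> 'N))"
    by (rule sum_perm_tensor[OF assms(1)])
  also have "\<dots> = (\<Sum>i\<in>tuples n. of_bool (i \<circ> (\<sigma> \<circ> inv \<tau>) = (i :: nat \<Rightarrow> 'N)))"
  proof (intro sum.cong refl)
    fix i :: "nat \<Rightarrow> 'N" assume i: "i \<in> tuples n"
    have "i \<circ> \<sigma> = i \<circ> \<tau> \<longleftrightarrow> i \<circ> (\<sigma> \<circ> inv \<tau>) = i"
      using comp_permutes_eq_iff[OF assms(2), of i "i \<circ> \<sigma>"] by (auto simp: comp_assoc)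
    then show "perm_tensor n \<tau> (i \<circ> \<sigma>, i) = of_bool (i \<circ> (\<sigma> \<circ> inv \<tau>) = i)"
      by (simp add: perm_tensor_on_tuples[OF tuples_comp[OF i assms(1)] i assms(2)])
  qed
  also have "\<dots> = of_nat (card {i \<in> tuples n. i \<circ> (\<sigma> \<circ> inv \<tau>) = (i :: nat \<Rightarrow> 'N)})"
    by (simp only: sum_of_bool_eq finite_tuples Int_def mem_Collect_eq)
  finally show ?thesis
    unfolding card_tuples_fixed_by[OF permutes_compose[OF permutes_inv[OF assms(2)] assms(1)]]
      gram_matrix_def by simp
qed

lemma gram_matrix_invertible:
  "invertible_on (perms_no_decreasing CARD('N::finite) n) (gram_matrix CARD('N) n)"
proof (rule invertible_on_if_rows_independent[OF finite_perms_no_decreasing])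
  let ?S = "perms_no_decreasing CARD('N) n"
  let ?T = "tuples n \<times> tuples n :: ((nat \<Rightarrow> 'N) \<times> (nat \<Rightarrow> 'N)) set"
  have "lin_indep_on ?S (\<lambda>\<sigma> \<tau>. \<Sum>p\<in>?T. perm_tensor n \<sigma> p * cnj (perm_tensor n \<tau> p)) ?S"
    using finite_cartesian_product[OF finite_tuples finite_tuples] lin_indep_on_perm_tensor
    by (rule lin_indep_on_gram)
  moreover have "(\<Sum>p\<in>?T. perm_tensor n \<sigma> p * cnj (perm_tensor n \<tau> p)) = gram_matrix CARD('N) n \<sigma> \<tau>"
    if "\<sigma> \<in> ?S" "\<tau> \<in> ?S" for \<sigma> \<tau>
  proof -
    have "cnj (perm_tensor n \<tau> p) = perm_tensor n \<tau> p" for p :: "(nat \<Rightarrow> 'N) \<times> (nat \<Rightarrow> 'N)"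
      by (simp add: perm_tensor_def of_bool_def)
    then show ?thesis
      using perm_tensor_gram[OF that[THEN perms_no_decreasing_permutes], where 'N = 'N] by simp
  qed
  ultimately show "lin_indep_on ?S (gram_matrix CARD('N) n) ?S"
    by (rule lin_indep_on_cong[THEN iffD1, rotated])
qed

section \<open>Commutants of tensor powers\<close>

definition kernel_comp ::
  "'i set \<Rightarrow> ('i \<times> 'i \<Rightarrow> complex) \<Rightarrow> ('i \<times> 'i \<Rightarrow> complex) \<Rightarrow> 'i \<times> 'i \<Rightarrow> complex" where
  "kernel_comp T K L p = (\<Sum>k\<in>T. K (fst p, k) * L (k, snd p))"

definition commutant :: "'i set \<Rightarrow> ('i \<times> 'i \<Rightarrow> complex) \<Rightarrow> ('i \<times> 'i \<Rightarrow> complex) set" where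
  "commutant T W = {K. \<forall>p\<in>T \<times> T. kernel_comp T W K p = kernel_comp T K W p}"

lemma commutantD:
  "K \<in> commutant T W \<Longrightarrow> p \<in> T \<times> T \<Longrightarrow> kernel_comp T W K p = kernel_comp T K W p"
  unfolding commutant_def by blast

lemma kernel_comp_assoc:
  "kernel_comp T (kernel_comp T K L) M p = kernel_comp T K (kernel_comp T L M) p"
  unfolding kernel_comp_def sum_distrib_left sum_distrib_right
  by (subst sum.swap) (simp add: mult.assoc)

lemma kernel_comp_cong:
  assumes "p \<in> T \<times> T" and "\<And>q. q \<in> T \<times> T \<Longrightarrow> K q = K' q" and "\<And>q. q \<in> T \<times> T \<Longrightarrow> L q = L' q"
  shows "kernel_comp T K L p = kernel_comp T K' L' p"
  unfolding kernel_comp_def using assms by (intro sum.cong refl) (auto simp: mem_Times_iff)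

lemma kernel_comp_sum:
  "kernel_comp T (\<lambda>p. \<Sum>x\<in>A. K x p) (\<lambda>p. \<Sum>y\<in>B. L y p) p = (\<Sum>y\<in>B. \<Sum>x\<in>A. kernel_comp T (K x) (L y) p)"
  unfolding kernel_comp_def sum_product
  by (subst sum.swap, subst (2) sum.swap, subst sum.swap) (rule refl)

lemma subspace_commutant: "complex_fun.subspace (commutant T W)"
  by (rule complex_fun.subspaceI)
     (auto simp: commutant_def kernel_comp_def distrib_left distrib_right sum.distrib
        mult.assoc mult.left_commute simp flip: sum_distrib_left)

lemma commutant_cong:
  assumes "K \<in> commutant T W" and "\<And>p. p \<in> T \<times> T \<Longrightarrow> K p = L p"
  shows "L \<in> commutant T W"
proof -
  have "kernel_comp T W L p = kernel_comp T L W p" if "p \<in> T \<times> T" for p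
    using commutantD[OF assms(1) that] assms(2)
      kernel_comp_cong[OF that, of K L W W] kernel_comp_cong[OF that, of W W K L] by simp
  then show ?thesis unfolding commutant_def by blast
qed

lemma commutant_comp:
  assumes "K \<in> commutant T W" and "L \<in> commutant T W"
  shows "kernel_comp T K L \<in> commutant T W"
  unfolding commutant_def mem_Collect_eq
proof
  fix p assume p: "p \<in> T \<times> T"
  have "kernel_comp T W (kernel_comp T K L) p = kernel_comp T (kernel_comp T W K) L p"
    by (simp only: kernel_comp_assoc)
  also have "\<dots> = kernel_comp T (kernel_comp T K W) L p"
    by (intro kernel_comp_cong[OF p] commutantD[OF assms(1)] refl)
  also have "\<dots> = kernel_comp T K (kernel_comp T W L) p"
    by (simp only: kernel_comp_assoc)
  also have "\<dots> = kernel_comp T K (kernel_comp T L W) p"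
    by (intro kernel_comp_cong[OF p] commutantD[OF assms(2)] refl)
  finally show "kernel_comp T W (kernel_comp T K L) p = kernel_comp T (kernel_comp T K L) W p"
    by (simp only: kernel_comp_assoc)
qed

definition id_kernel :: "'a \<times> 'a \<Rightarrow> complex" where
  "id_kernel p = of_bool (fst p = snd p)"

lemma kernel_comp_id_kernel:
  fixes K :: "'a::finite \<times> 'a \<Rightarrow> complex"
  shows "kernel_comp UNIV id_kernel K = K" and "kernel_comp UNIV K id_kernel = K"
  by (simp_all add: fun_eq_iff kernel_comp_def id_kernel_def sum_of_bool_delta)

definition tensor :: "nat \<Rightarrow> (nat \<Rightarrow> 'a \<times> 'a \<Rightarrow> complex) \<Rightarrow> (nat \<Rightarrow> 'a) \<times> (nat \<Rightarrow> 'a) \<Rightarrow> complex" where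
  "tensor n X p = (\<Prod>k=1..n. X k (fst p k, snd p k))"

definition tensor_deriv :: "nat \<Rightarrow> ('a \<times> 'a \<Rightarrow> complex) \<Rightarrow> (nat \<Rightarrow> 'a) \<times> (nat \<Rightarrow> 'a) \<Rightarrow> complex" where
  "tensor_deriv n Y p = (\<Sum>q=1..n. tensor n ((\<lambda>_. id_kernel)(q := Y)) p)"

definition sym_tensor :: "nat \<Rightarrow> (nat \<Rightarrow> 'a \<times> 'a \<Rightarrow> complex) \<Rightarrow> (nat \<Rightarrow> 'a) \<times> (nat \<Rightarrow> 'a) \<Rightarrow> complex" where
  "sym_tensor n X p = (\<Sum>\<pi> | \<pi> permutes {1..n}. tensor n (X \<circ> \<pi>) p)"

lemma tensor_cong:
  "(\<And>k. k \<in> {1..n} \<Longrightarrow> X k = Y k) \<Longrightarrow> tensor n X = tensor n Y"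
  unfolding tensor_def by (intro ext prod.cong) auto

lemma tensor_id_kernel: "tensor n (\<lambda>_. id_kernel) = perm_tensor n id"
  by (auto simp: fun_eq_iff tensor_def perm_tensor_def id_kernel_def of_bool_def)

lemma kernel_comp_tensor:
  fixes X Y :: "nat \<Rightarrow> 'a::finite \<times> 'a \<Rightarrow> complex"
  shows "kernel_comp (tuples n) (tensor n X) (tensor n Y) =
    tensor n (\<lambda>k. kernel_comp UNIV (X k) (Y k))"
proof
  fix p :: "(nat \<Rightarrow> 'a) \<times> (nat \<Rightarrow> 'a)"
  have "tensor n (\<lambda>k. kernel_comp UNIV (X k) (Y k)) p =
      (\<Sum>g\<in>tuples n. \<Prod>k=1..n. X k (fst p k, g k) * Y k (g k, snd p k))"
    unfolding tensor_def kernel_comp_def tuples_def by (subst prod_sum_PiE) auto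
  then show "kernel_comp (tuples n) (tensor n X) (tensor n Y) p =
      tensor n (\<lambda>k. kernel_comp UNIV (X k) (Y k)) p"
    by (simp add: kernel_comp_def tensor_def prod.distrib)
qed

lemma sym_tensor_permute:
  assumes "\<pi> permutes {1..n}"
  shows "sym_tensor n (X \<circ> \<pi>) = sym_tensor n X"
  unfolding sym_tensor_def comp_assoc
  by (intro ext setum_permutations_compose_left[OF assms, symmetric])

lemma sym_tensor_exchange:
  assumes "q \<in> {1..n}" and "l \<in> {1..n}" and "X q = X l"
  shows "sym_tensor n (X(l := Y)) = sym_tensor n (X(q := Y))"
proof -
  have "X(l := Y) = X(q := Y) \<circ> Transposition.transpose q l"
    using assms(3) by (auto simp: fun_eq_iff Transposition.transpose_def)
  then show ?thesis
    using sym_tensor_permute[OF permutes_swap_id[OF assms(1,2)]] by metis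
qed

lemma kernel_comp_tensor_deriv_sym_tensor:
  fixes X :: "nat \<Rightarrow> 'a::finite \<times> 'a \<Rightarrow> complex"
  shows "kernel_comp (tuples n) (tensor_deriv n Y) (sym_tensor n X) p =
    (\<Sum>l=1..n. sym_tensor n (X(l := kernel_comp UNIV Y (X l))) p)"
proof -
  let ?P = "{\<pi>. \<pi> permutes {1..n}}"
  let ?Y = "\<lambda>l. X(l := kernel_comp UNIV Y (X l))"
  have "kernel_comp (tuples n) (tensor_deriv n Y) (sym_tensor n X) p = (\<Sum>\<pi>\<in>?P. \<Sum>q=1..n.
      kernel_comp (tuples n) (tensor n ((\<lambda>_. id_kernel)(q := Y))) (tensor n (X \<circ> \<pi>)) p)"
    unfolding tensor_deriv_def[abs_def] sym_tensor_def[abs_def] by (rule kernel_comp_sum)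
  also have "\<dots> = (\<Sum>\<pi>\<in>?P. \<Sum>q=1..n. tensor n (?Y (\<pi> q) \<circ> \<pi>) p)"
  proof (intro sum.cong refl)
    fix \<pi> q assume "\<pi> \<in> ?P"
    then have "inj \<pi>" using permutes_inj by auto
    then have "(\<lambda>k. kernel_comp UNIV (((\<lambda>_. id_kernel)(q := Y)) k) ((X \<circ> \<pi>) k)) = ?Y (\<pi> q) \<circ> \<pi>"
      by (auto simp: fun_eq_iff kernel_comp_id_kernel dest: injD)
    then show "kernel_comp (tuples n) (tensor n ((\<lambda>_. id_kernel)(q := Y))) (tensor n (X \<circ> \<pi>)) p =
        tensor n (?Y (\<pi> q) \<circ> \<pi>) p"
      by (simp only: kernel_comp_tensor)
  qed
  also have "\<dots> = (\<Sum>\<pi>\<in>?P. \<Sum>l=1..n. tensor n (?Y l \<circ> \<pi>) p)"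
  proof (rule sum.cong[OF refl])
    fix \<pi> assume "\<pi> \<in> ?P"
    then have "bij_betw \<pi> {1..n} {1..n}" by (simp add: permutes_imp_bij)
    then show "(\<Sum>q=1..n. tensor n (?Y (\<pi> q) \<circ> \<pi>) p) = (\<Sum>l=1..n. tensor n (?Y l \<circ> \<pi>) p)"
      by (rule sum.reindex_bij_betw)
  qed
  also have "\<dots> = (\<Sum>l=1..n. sym_tensor n (?Y l) p)"
    unfolding sym_tensor_def by (rule sum.swap)
  finally show ?thesis .
qed

lemma perm_tensor_id_in_commutant:
  "perm_tensor n id \<in> commutant (tuples n) (W :: (nat \<Rightarrow> 'a::finite) \<times> (nat \<Rightarrow> 'a) \<Rightarrow> complex)"
proof -
  have "perm_tensor n id (i, j) = of_bool (i = j)"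
    if "i \<in> tuples n" "j \<in> tuples n" for i j :: "nat \<Rightarrow> 'a"
    using perm_tensor_on_tuples[OF that permutes_id] by simp
  then show ?thesis
    by (auto simp: commutant_def kernel_comp_def sum_of_bool_delta finite_tuples cong: sum.cong)
qed

lemma sym_tensor_id_kernel_in_commutant:
  fixes W :: "(nat \<Rightarrow> 'a::finite) \<times> (nat \<Rightarrow> 'a) \<Rightarrow> complex"
  assumes "\<And>l. l \<in> {1..n} \<Longrightarrow> X l = id_kernel"
  shows "sym_tensor n X \<in> commutant (tuples n) W"
proof -
  have "tensor n (X \<circ> \<pi>) = perm_tensor n id" if "\<pi> permutes {1..n}" for \<pi>
    using assms permutes_in_image[OF that] tensor_cong[of n "X \<circ> \<pi>" "\<lambda>_. id_kernel"]
    by (simp add: tensor_id_kernel)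
  then have "sym_tensor n X = (\<lambda>p. \<Sum>\<pi> | \<pi> permutes {1..n}. 1 * perm_tensor n id p)"
    by (simp add: fun_eq_iff sym_tensor_def)
  also have "\<dots> \<in> commutant (tuples n) W"
    by (intro subspace_linear_combination subspace_commutant perm_tensor_id_in_commutant)
  finally show ?thesis .
qed

text \<open>The number of slots of \<open>X\<close> that differ from the identity is increased one at a time: when \<open>Y\<close>
  acts on \<open>sym_tensor n X\<close>, the terms where \<open>Y\<close> hits an identity slot \<open>q\<close> all equal
  \<open>sym_tensor n (X(q := Y))\<close>, and the other terms have no new slot.\<close>

lemma kernel_comp_tensor_deriv_sym_tensor_split:
  fixes X :: "nat \<Rightarrow> 'a::finite \<times> 'a \<Rightarrow> complex"
  assumes "A \<subseteq> {1..n}" and "q \<in> {1..n} - A" and "\<And>l. l \<in> {1..n} - A \<Longrightarrow> X l = id_kernel"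
  shows "kernel_comp (tuples n) (tensor_deriv n Y) (sym_tensor n X) p =
    of_nat (card ({1..n} - A)) * sym_tensor n (X(q := Y)) p +
    (\<Sum>l\<in>A. sym_tensor n (X(l := kernel_comp UNIV Y (X l))) p)"
proof -
  have "sym_tensor n (X(l := kernel_comp UNIV Y (X l))) p = sym_tensor n (X(q := Y)) p"
    if "l \<in> {1..n} - A" for l
    using that assms(2) sym_tensor_exchange[of q n l X] assms(3) by (simp add: kernel_comp_id_kernel)
  then have "(\<Sum>l\<in>{1..n} - A. sym_tensor n (X(l := kernel_comp UNIV Y (X l))) p) =
      of_nat (card ({1..n} - A)) * sym_tensor n (X(q := Y)) p"
    by simp
  then show ?thesis
    by (simp only: kernel_comp_tensor_deriv_sym_tensor
        sum.subset_diff[OF assms(1) finite_atLeastAtMost])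
qed

lemma sym_tensor_in_commutant:
  fixes W :: "(nat \<Rightarrow> 'a::finite) \<times> (nat \<Rightarrow> 'a) \<Rightarrow> complex"
  assumes deriv: "\<And>Y. tensor_deriv n Y \<in> commutant (tuples n) W"
    and "A \<subseteq> {1..n}" and "\<And>l. l \<in> {1..n} - A \<Longrightarrow> X l = id_kernel"
  shows "sym_tensor n X \<in> commutant (tuples n) W"
  using finite_subset[OF assms(2) finite_atLeastAtMost] assms(2,3)
proof (induction A arbitrary: X)
  case empty
  then show ?case by (intro sym_tensor_id_kernel_in_commutant) simp
next
  case (insert q A)
  define X0 where "X0 = X(q := id_kernel)"
  define m where "m = complex_of_nat (card ({1..n} - A))"
  let ?K = "kernel_comp (tuples n) (tensor_deriv n (X q)) (sym_tensor n X0)"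
  let ?L = "\<lambda>l. sym_tensor n (X0(l := kernel_comp UNIV (X q) (X0 l)))"
  have A: "A \<subseteq> {1..n}" and q: "q \<in> {1..n} - A"
    using insert.hyps insert.prems(1) by auto
  have X0: "X0 l = id_kernel" if "l \<in> {1..n} - A" for l
    using insert.prems(2)[of l] that by (auto simp: X0_def)
  have "?K \<in> commutant (tuples n) W"
    by (intro commutant_comp deriv insert.IH[OF A X0])
  moreover have "?L l \<in> commutant (tuples n) W" if "l \<in> A" for l
    using X0 that by (intro insert.IH[OF A]) auto
  then have "(\<lambda>p. \<Sum>l\<in>A. 1 * ?L l p) \<in> commutant (tuples n) W"
    by (intro subspace_linear_combination subspace_commutant)
  ultimately have "(\<lambda>p. 1 / m * (?K - (\<lambda>p. \<Sum>l\<in>A. 1 * ?L l p)) p) \<in> commutant (tuples n) W"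
    by (intro complex_fun.subspace_scale complex_fun.subspace_diff subspace_commutant)
  also have "(\<lambda>p. 1 / m * (?K - (\<lambda>p. \<Sum>l\<in>A. 1 * ?L l p)) p) = sym_tensor n X"
  proof
    fix p
    have "m \<noteq> 0" using q by (auto simp: m_def card_eq_0_iff)
    moreover have "?K p = m * sym_tensor n (X0(q := X q)) p + (\<Sum>l\<in>A. ?L l p)"
      unfolding m_def by (rule kernel_comp_tensor_deriv_sym_tensor_split[OF A q X0])
    moreover have "X0(q := X q) = X" by (simp add: X0_def)
    ultimately show "1 / m * (?K - (\<lambda>p. \<Sum>l\<in>A. 1 * ?L l p)) p = sym_tensor n X p"
      by simp
  qed
  finally show ?case .
qed

definition matrix_units :: "(nat \<Rightarrow> 'a) \<times> (nat \<Rightarrow> 'a) \<Rightarrow> nat \<Rightarrow> 'a \<times> 'a \<Rightarrow> complex" where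
  "matrix_units q l p = of_bool (p = (fst q l, snd q l))"

lemma symmetric_kernel_expansion:
  fixes K :: "(nat \<Rightarrow> 'a::finite) \<times> (nat \<Rightarrow> 'a) \<Rightarrow> complex"
  assumes symmetric: "\<And>\<pi> i j. \<pi> permutes {1..n} \<Longrightarrow> K (i \<circ> \<pi>, j \<circ> \<pi>) = K (i, j)"
    and i: "i \<in> tuples n" and j: "j \<in> tuples n"
  shows "(\<Sum>q\<in>tuples n \<times> tuples n. K q / fact n * sym_tensor n (matrix_units q) (i, j)) = K (i, j)"
proof -
  let ?P = "{\<pi>. \<pi> permutes {1..n}}"
  have tensor_units: "tensor n (matrix_units q \<circ> \<pi>) (i, j) =
      perm_tensor n \<pi> (i, fst q) * perm_tensor n \<pi> (j, snd q)" for q \<pi>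
    by (auto simp: tensor_def perm_tensor_def matrix_units_def of_bool_def)
  have "(\<Sum>q\<in>tuples n \<times> tuples n. K q / fact n * sym_tensor n (matrix_units q) (i, j)) =
      (\<Sum>\<pi>\<in>?P. \<Sum>q\<in>tuples n \<times> tuples n.
        perm_tensor n \<pi> (i, fst q) * (perm_tensor n \<pi> (j, snd q) * (K q / fact n)))"
    unfolding sym_tensor_def sum_distrib_left tensor_units by (subst sum.swap) (simp only: mult_ac)
  also have "\<dots> = (\<Sum>\<pi>\<in>?P. \<Sum>a\<in>tuples n. perm_tensor n \<pi> (i, a) *
      (\<Sum>b\<in>tuples n. perm_tensor n \<pi> (j, b) * (K (a, b) / fact n)))"
    by (simp add: sum.cartesian_product' sum_distrib_left)
  also have "\<dots> = (\<Sum>\<pi>\<in>?P. K (i, j) / fact n)"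
    by (intro sum.cong refl)
       (simp only: mem_Collect_eq sum_perm_tensor_snd i j symmetric[OF permutes_inv])
  also have "\<dots> = K (i, j)"
    by (simp add: card_permutations)
  finally show ?thesis .
qed

lemma symmetric_kernel_in_commutant:
  fixes W K :: "(nat \<Rightarrow> 'a::finite) \<times> (nat \<Rightarrow> 'a) \<Rightarrow> complex"
  assumes "\<And>Y. tensor_deriv n Y \<in> commutant (tuples n) W"
    and "\<And>\<pi> i j. \<pi> permutes {1..n} \<Longrightarrow> K (i \<circ> \<pi>, j \<circ> \<pi>) = K (i, j)"
  shows "K \<in> commutant (tuples n) W"
proof (rule commutant_cong)
  show "(\<lambda>p. \<Sum>q\<in>tuples n \<times> tuples n. K q / fact n * sym_tensor n (matrix_units q) p) \<in>
      commutant (tuples n) W"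
    using sym_tensor_in_commutant[OF assms(1), where A = "{1..n}"]
    by (intro subspace_linear_combination subspace_commutant) simp
qed (use symmetric_kernel_expansion[of n K, OF assms(2)] in auto)

section \<open>Schur--Weyl duality\<close>

definition perm_projection ::
  "nat \<Rightarrow> (nat \<Rightarrow> 'N::finite) \<times> (nat \<Rightarrow> 'N) \<Rightarrow> (nat \<Rightarrow> 'N) \<times> (nat \<Rightarrow> 'N) \<Rightarrow> complex" where
  "perm_projection n = gram_kernel (perms_no_decreasing CARD('N) n)
     (inverse_on (perms_no_decreasing CARD('N) n) (gram_matrix CARD('N) n)) (perm_tensor n)"

abbreviation perm_span :: "nat \<Rightarrow> ((nat \<Rightarrow> 'N::finite) \<times> (nat \<Rightarrow> 'N) \<Rightarrow> complex) set" where
  "perm_span n \<equiv> complex_fun.span (perm_tensor n ` perms_no_decreasing CARD('N) n)"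

lemma perm_projection_in_span:
  "(\<lambda>p. perm_projection n p q) \<in> perm_span n" "(\<lambda>p. perm_projection n q p) \<in> perm_span n"
  unfolding perm_projection_def by (rule gram_kernel_in_span)+

lemma perm_projection_reproducing:
  assumes "f \<in> perm_span n"
  shows "(\<Sum>q\<in>tuples n \<times> tuples n. perm_projection n p q * f q) = f p"
    and "(\<Sum>p\<in>tuples n \<times> tuples n. f p * perm_projection n p q) = f q"
  unfolding perm_projection_def
  by (intro gram_kernel_reproducing[OF finite_perms_no_decreasing
        is_inverse_on_inverse_on[OF gram_matrix_invertible] _ assms]
        perm_tensor_gram perms_no_decreasing_permutes; assumption)+

lemma perm_span_comp:
  assumes "\<pi> permutes {1..n}" and "f \<in> perm_span n"
  shows "(\<lambda>p. f (fst p \<circ> \<pi>, snd p)) \<in> (perm_span n :: ((nat \<Rightarrow> 'N::finite) \<times> (nat \<Rightarrow> 'N) \<Rightarrow> complex) set)"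
proof -
  let ?V = "{f. (\<lambda>p. f (fst p \<circ> \<pi>, snd p)) \<in> (perm_span n :: ((nat \<Rightarrow> 'N) \<times> (nat \<Rightarrow> 'N) \<Rightarrow> complex) set)}"
  have "complex_fun.subspace ?V"
    using complex_fun.span_zero complex_fun.span_add complex_fun.span_scale
    by (intro complex_fun.subspaceI) (simp_all add: zero_fun_def plus_fun_def)
  moreover have "perm_tensor n ` perms_no_decreasing CARD('N) n \<subseteq> ?V"
    using perm_tensor_in_span[OF permutes_compose[OF permutes_inv[OF assms(1)]
        perms_no_decreasing_permutes]]
    by (auto simp: perm_tensor_comp[OF assms(1)])
  ultimately show ?thesis
    using complex_fun.span_minimal assms(2) by blast
qed

text \<open>Both sides are reproducing kernels of the span of the permutation tensors, and a space has at
  most one reproducing kernel.\<close>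

lemma perm_projection_permute:
  fixes i i' k k' :: "nat \<Rightarrow> 'N::finite"
  assumes \<pi>: "\<pi> permutes {1..n}"
  shows "perm_projection n (i \<circ> \<pi>, i') (k \<circ> \<pi>, k') = perm_projection n (i, i') (k, k')"
proof -
  let ?R = "perm_projection n :: (nat \<Rightarrow> 'N) \<times> (nat \<Rightarrow> 'N) \<Rightarrow> _"
  have "?R (i \<circ> \<pi>, i') (k \<circ> \<pi>, k') =
      (\<Sum>p\<in>tuples n \<times> tuples n. ?R (i \<circ> \<pi>, i') (fst p \<circ> \<pi>, snd p) * ?R p (k, k'))"
    using perm_projection_reproducing(2)[OF perm_span_comp[OF \<pi> perm_projection_in_span(2)],
        of "(i \<circ> \<pi>, i')" "(k, k')"] by simp
  also have "\<dots> = (\<Sum>a'\<in>tuples n. \<Sum>a\<in>tuples n.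
      ?R (i \<circ> \<pi>, i') (a \<circ> \<pi>, a') * ?R (a \<circ> \<pi> \<circ> inv \<pi>, a') (k, k'))"
    using permutes_inv_o[OF \<pi>]
    by (subst sum.swap) (simp add: sum.cartesian_product' comp_assoc)
  also have "\<dots> = (\<Sum>a'\<in>tuples n. \<Sum>a\<in>tuples n. ?R (i \<circ> \<pi>, i') (a, a') * ?R (a \<circ> inv \<pi>, a') (k, k'))"
    by (intro sum.cong refl sum_tuples_comp[OF \<pi>])
  also have "\<dots> = (\<Sum>p\<in>tuples n \<times> tuples n. ?R (i \<circ> \<pi>, i') p * ?R (fst p \<circ> inv \<pi>, snd p) (k, k'))"
    by (subst sum.swap) (simp add: sum.cartesian_product')
  also have "\<dots> = ?R (i \<circ> \<pi> \<circ> inv \<pi>, i') (k, k')"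
    using perm_projection_reproducing(1)[OF perm_span_comp[OF permutes_inv[OF \<pi>]
          perm_projection_in_span(1)], of "(i \<circ> \<pi>, i')" "(k, k')"] by simp
  also have "\<dots> = ?R (i, i') (k, k')"
    using permutes_inv_o[OF \<pi>] by (simp add: comp_assoc)
  finally show ?thesis .
qed

text \<open>For fixed \<open>i'\<close> and \<open>k'\<close>, the projection is a symmetric kernel in the other two arguments, hence
  commutes with \<open>W\<close>; so \<open>W = W (P 1) = P (W 1) = P W\<close>.\<close>

lemma commutant_perm_projection:
  fixes W :: "(nat \<Rightarrow> 'N::finite) \<times> (nat \<Rightarrow> 'N) \<Rightarrow> complex"
  assumes "\<And>Y. tensor_deriv n Y \<in> commutant (tuples n) W" and "p \<in> tuples n \<times> tuples n"
  shows "W p = (\<Sum>q\<in>tuples n \<times> tuples n. perm_projection n p q * W q)"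
proof -
  obtain i i' where p: "p = (i, i')" "i \<in> tuples n" "i' \<in> tuples n"
    using assms(2) by blast
  let ?R = "perm_projection n :: (nat \<Rightarrow> 'N) \<times> (nat \<Rightarrow> 'N) \<Rightarrow> _"
  have projection_id: "(\<Sum>k'\<in>tuples n. ?R (k, i') (k', k')) = of_bool (k = i')" if "k \<in> tuples n" for k
  proof -
    have "(\<Sum>k'\<in>tuples n. ?R (k, i') (k', k')) =
        (\<Sum>q\<in>tuples n \<times> tuples n. ?R (k, i') q * perm_tensor n id q)"
      using sum_perm_tensor[OF permutes_id, of n "?R (k, i')"] by (simp add: mult.commute)
    also have "\<dots> = perm_tensor n id (k, i')"
      by (rule perm_projection_reproducing(1)[OF perm_tensor_in_span[OF permutes_id]])
    also have "\<dots> = of_bool (k = i')"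
      using perm_tensor_on_tuples[OF that p(3) permutes_id] by simp
    finally show ?thesis .
  qed
  have commute: "(\<Sum>k\<in>tuples n. W (i, k) * ?R (k, i') (k', k')) =
      (\<Sum>k\<in>tuples n. ?R (i, i') (k, k') * W (k, k'))" if "k' \<in> tuples n" for k'
  proof -
    have "(\<lambda>(i, k). ?R (i, i') (k, k')) \<in> commutant (tuples n) W"
      by (rule symmetric_kernel_in_commutant[OF assms(1)]) (simp add: perm_projection_permute)
    then show ?thesis
      using p(2) that by (auto simp: commutant_def kernel_comp_def)
  qed
  have "W p = (\<Sum>k\<in>tuples n. W (i, k) * (\<Sum>k'\<in>tuples n. ?R (k, i') (k', k')))"
    using p by (simp add: projection_id sum_of_bool_delta finite_tuples)
  also have "\<dots> = (\<Sum>k'\<in>tuples n. \<Sum>k\<in>tuples n. W (i, k) * ?R (k, i') (k', k'))"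
    unfolding sum_distrib_left by (rule sum.swap)
  also have "\<dots> = (\<Sum>k'\<in>tuples n. \<Sum>k\<in>tuples n. ?R (i, i') (k, k') * W (k, k'))"
    by (intro sum.cong refl commute)
  also have "\<dots> = (\<Sum>q\<in>tuples n \<times> tuples n. ?R p q * W q)"
    by (subst sum.swap) (simp add: sum.cartesian_product' p(1))
  finally show ?thesis .
qed

section \<open>Commuting with all unitary tensor powers\<close>

definition rank_one :: "('a \<Rightarrow> complex) \<Rightarrow> 'a \<times> 'a \<Rightarrow> complex" where
  "rank_one x p = x (fst p) * cnj (x (snd p))"

lemma span_rank_one: "complex_fun.span (range rank_one) = (UNIV :: ('a::finite \<times> 'a \<Rightarrow> complex) set)"
proof -
  have polarization: "(\<lambda>p. x (fst p) * cnj (y (snd p))) \<in> complex_fun.span (range rank_one)"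
    for x y :: "'a \<Rightarrow> complex"
  proof -
    have "(\<lambda>p. \<Sum>k<4. \<i> ^ k / 4 * rank_one (\<lambda>a. x a + \<i> ^ k * y a) p) \<in>
        complex_fun.span (range rank_one)"
      by (intro subspace_linear_combination complex_fun.subspace_span complex_fun.span_base rangeI)
    also have "(\<lambda>p. \<Sum>k<4. \<i> ^ k / 4 * rank_one (\<lambda>a. x a + \<i> ^ k * y a) p) =
        (\<lambda>p. x (fst p) * cnj (y (snd p)))"
      by (simp add: fun_eq_iff rank_one_def numeral_eq_Suc field_simps)
    finally show ?thesis .
  qed
  have "Y \<in> complex_fun.span (range rank_one)" for Y :: "'a \<times> 'a \<Rightarrow> complex"
  proof -
    have "(\<lambda>p. \<Sum>q\<in>UNIV. Y q * (of_bool (fst p = fst q) * cnj (of_bool (snd p = snd q)))) \<in>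
        complex_fun.span (range rank_one)"
      by (intro subspace_linear_combination complex_fun.subspace_span polarization)
    also have "(\<lambda>p. \<Sum>q\<in>UNIV. Y q * (of_bool (fst p = fst q) * cnj (of_bool (snd p = snd q)))) = Y"
    proof
      fix p
      have "(\<Sum>q\<in>UNIV. Y q * (of_bool (fst p = fst q) * cnj (of_bool (snd p = snd q)))) =
          (\<Sum>q\<in>UNIV. Y q * of_bool (p = q))"
        by (intro sum.cong refl) (auto simp: prod_eq_iff)
      then show "(\<Sum>q\<in>UNIV. Y q * (of_bool (fst p = fst q) * cnj (of_bool (snd p = snd q)))) = Y p"
        by (simp add: sum_of_bool_delta)
    qed
    finally show ?thesis .
  qed
  then show ?thesis by blast
qed

lemma tensor_deriv_eq:
  "tensor_deriv n Y p =
     (\<Sum>q=1..n. Y (fst p q, snd p q) * (\<Prod>k\<in>{1..n} - {q}. id_kernel (fst p k, snd p k)))"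
  unfolding tensor_deriv_def
proof (intro sum.cong refl)
  fix q assume "q \<in> {1..n}"
  then show "tensor n ((\<lambda>_. id_kernel)(q := Y)) p =
      Y (fst p q, snd p q) * (\<Prod>k\<in>{1..n} - {q}. id_kernel (fst p k, snd p k))"
    unfolding tensor_def by (subst prod.remove[of _ q]) (auto intro!: prod.cong)
qed

lemma subspace_vimage_tensor_deriv:
  fixes V :: "((nat \<Rightarrow> 'a) \<times> (nat \<Rightarrow> 'a) \<Rightarrow> complex) set"
  assumes "complex_fun.subspace V"
  shows "complex_fun.subspace (tensor_deriv n -` V)"
proof (rule complex_fun.subspaceI; unfold vimage_eq)
  have "tensor_deriv n (0 :: 'a \<times> 'a \<Rightarrow> complex) = 0"
    by (simp add: fun_eq_iff tensor_deriv_eq)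
  then show "tensor_deriv n 0 \<in> V"
    using complex_fun.subspace_0[OF assms] by simp
  fix Y Z c
  assume Y: "tensor_deriv n Y \<in> V"
  have "tensor_deriv n (\<lambda>p. c * Y p) = (\<lambda>p. c * tensor_deriv n Y p)"
    by (simp add: fun_eq_iff tensor_deriv_eq sum_distrib_left mult.assoc)
  then show "tensor_deriv n (\<lambda>p. c * Y p) \<in> V"
    using complex_fun.subspace_scale[OF assms Y] by simp
  assume Z: "tensor_deriv n Z \<in> V"
  have "tensor_deriv n (Y + Z) = tensor_deriv n Y + tensor_deriv n Z"
    by (simp add: fun_eq_iff tensor_deriv_eq distrib_right sum.distrib)
  then show "tensor_deriv n (Y + Z) \<in> V"
    using complex_fun.subspace_add[OF assms Y Z] by simp
qed

lemma tensor_has_vector_derivative: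
  assumes "X 0 = id_kernel" and "\<And>p. ((\<lambda>t. X t p) has_vector_derivative Y p) (at 0)"
  shows "((\<lambda>t. tensor n (\<lambda>_. X t) p) has_vector_derivative tensor_deriv n Y p) (at 0)"
proof -
  have "((\<lambda>t. \<Prod>k=1..n. X t (fst p k, snd p k)) has_derivative
      (\<lambda>h. \<Sum>q=1..n. (h *\<^sub>R Y (fst p q, snd p q)) * (\<Prod>k\<in>{1..n} - {q}. X 0 (fst p k, snd p k)))) (at 0)"
    by (rule has_derivative_prod) (use assms(2) in \<open>simp add: has_vector_derivative_def\<close>)
  then show ?thesis
    unfolding has_vector_derivative_def tensor_def[abs_def] tensor_deriv_eq
    by (simp add: assms(1) scaleR_sum_right)
qed

lemma commutant_has_vector_derivative:
  assumes "\<And>t. K t \<in> commutant T W"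
    and deriv: "\<And>p. ((\<lambda>t. K t p) has_vector_derivative K' p) (at t)"
  shows "K' \<in> commutant T W"
  unfolding commutant_def mem_Collect_eq
proof
  fix p assume "p \<in> T \<times> T"
  then have "kernel_comp T W (K s) p = kernel_comp T (K s) W p" for s
    by (rule commutantD[OF assms(1)])
  moreover have "((\<lambda>t. kernel_comp T W (K t) p) has_vector_derivative kernel_comp T W K' p) (at t)"
    unfolding kernel_comp_def
    by (intro has_vector_derivative_sum has_vector_derivative_mult_right deriv)
  moreover have "((\<lambda>t. kernel_comp T (K t) W p) has_vector_derivative kernel_comp T K' W p) (at t)"
    unfolding kernel_comp_def
    by (intro has_vector_derivative_sum has_vector_derivative_mult_left deriv)
  ultimately show "kernel_comp T W K' p = kernel_comp T K' W p"
    by (simp only: vector_derivative_unique_at)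
qed

abbreviation conj_transpose :: "complex ^ 'N ^ 'N \<Rightarrow> complex ^ 'N ^ 'N" where
  "conj_transpose U \<equiv> transpose (map_matrix cnj U)"

definition entries :: "complex ^ 'N ^ 'N \<Rightarrow> 'N \<times> 'N \<Rightarrow> complex" where
  "entries U p = U $ fst p $ snd p"

abbreviation tensor_power ::
  "nat \<Rightarrow> complex ^ 'N ^ 'N \<Rightarrow> (nat \<Rightarrow> 'N) \<times> (nat \<Rightarrow> 'N) \<Rightarrow> complex" where
  "tensor_power n U \<equiv> tensor n (\<lambda>_. entries U)"

lemma unitary_group_iff:
  "U \<in> unitary_group \<longleftrightarrow> (\<forall>a b. (\<Sum>c\<in>UNIV. U $ a $ c * cnj (U $ b $ c)) = of_bool (a = b))"
proof -
  have "U \<in> unitary_group \<longleftrightarrow> U ** conj_transpose U = mat 1"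
    unfolding unitary_group_def using matrix_left_right_inverse by blast
  then show ?thesis
    by (simp add: vec_eq_iff matrix_matrix_mult_def transpose_def map_matrix_def mat_def of_bool_def)
qed

text \<open>The unitary \<open>1 + (e\<^bsup>it\<^esup> - 1) P\<close>, where \<open>P\<close> is the orthogonal projection onto the line spanned
  by \<open>x\<close>; for \<open>x = 0\<close> the division by zero makes it the identity.\<close>

definition phase_reflection :: "('a::finite \<Rightarrow> complex) \<Rightarrow> real \<Rightarrow> 'a \<times> 'a \<Rightarrow> complex" where
  "phase_reflection x t p =
     id_kernel p + (cis t - 1) / (\<Sum>a\<in>UNIV. x a * cnj (x a)) * rank_one x p"

lemma phase_reflection_unitary: "(\<chi> a b. phase_reflection x t (a, b)) \<in> unitary_group"
  unfolding unitary_group_iff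
proof (intro allI)
  fix a b
  define r where "r = (\<Sum>c\<in>UNIV. x c * cnj (x c))"
  define w where "w = (cis t - 1) / r"
  have "cnj r = r"
    by (simp add: r_def mult.commute)
  then have cnj_w: "cnj w = (cnj (cis t) - 1) / r"
    by (simp add: w_def)
  have "cis t * cnj (cis t) = 1"
    by (simp add: cis_cnj cis_mult)
  then have w: "w + cnj w + w * cnj w * r = 0"
    unfolding cnj_w by (cases "r = 0") (simp_all add: w_def field_simps)
  have "(\<Sum>c\<in>UNIV. phase_reflection x t (a, c) * cnj (phase_reflection x t (b, c))) =
      (\<Sum>c\<in>UNIV. of_bool (a = c) * of_bool (b = c) + of_bool (a = c) * (cnj w * cnj (x b) * x c) +
        of_bool (b = c) * (w * x a * cnj (x c)) + w * cnj w * x a * cnj (x b) * (x c * cnj (x c)))"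
    by (intro sum.cong refl)
       (simp add: phase_reflection_def id_kernel_def rank_one_def algebra_simps flip: r_def w_def)
  also have "\<dots> = of_bool (a = b) + (w + cnj w + w * cnj w * r) * x a * cnj (x b)"
    unfolding sum.distrib sum_distrib_left[symmetric] r_def[symmetric]
      sum_of_bool_delta(2)[OF finite_class.finite_UNIV UNIV_I]
    by (auto simp: algebra_simps)
  finally show "(\<Sum>c\<in>UNIV. (\<chi> a b. phase_reflection x t (a, b)) $ a $ c *
      cnj ((\<chi> a b. phase_reflection x t (a, b)) $ b $ c)) = of_bool (a = b)"
    using w by simp
qed

lemma phase_reflection_has_vector_derivative:
  "((\<lambda>t. phase_reflection x t p) has_vector_derivative
     \<i> / (\<Sum>a\<in>UNIV. x a * cnj (x a)) * rank_one x p) (at 0)"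
proof -
  have "((\<lambda>t. exp (\<i> * complex_of_real t)) has_vector_derivative \<i>) (at 0)"
    by (rule has_vector_derivative_real_field) (auto intro!: derivative_eq_intros)
  then have "(cis has_vector_derivative \<i>) (at 0)"
    by (simp add: cis_conv_exp[abs_def])
  then show ?thesis
    unfolding phase_reflection_def by (auto intro!: derivative_eq_intros)
qed

lemma tensor_deriv_rank_one_in_commutant:
  fixes W :: "(nat \<Rightarrow> 'N::finite) \<times> (nat \<Rightarrow> 'N) \<Rightarrow> complex"
  assumes unitary: "\<And>U. U \<in> unitary_group \<Longrightarrow> tensor_power n U \<in> commutant (tuples n) W"
  shows "tensor_deriv n (rank_one x) \<in> commutant (tuples n) W"
proof -
  let ?V = "tensor_deriv n -` commutant (tuples n) W"
  note V = subspace_vimage_tensor_deriv[OF subspace_commutant]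
  define r where "r = (\<Sum>a\<in>UNIV. x a * cnj (x a))"
  have "tensor n (\<lambda>_. phase_reflection x t) \<in> commutant (tuples n) W" for t
    using unitary[OF phase_reflection_unitary, of x t] by (simp add: entries_def[abs_def])
  moreover have "phase_reflection x 0 = id_kernel"
    by (simp add: fun_eq_iff phase_reflection_def)
  note tensor_has_vector_derivative[OF this phase_reflection_has_vector_derivative]
  ultimately have "(\<lambda>p. \<i> / r * rank_one x p) \<in> ?V"
    unfolding r_def vimage_eq by (rule commutant_has_vector_derivative)
  then have scaled: "(\<lambda>p. r / \<i> * (\<i> / r * rank_one x p)) \<in> ?V"
    by (rule complex_fun.subspace_scale[OF V])
  have "rank_one x \<in> ?V"
  proof (cases "r = 0")
    case True
    have "r = complex_of_real (\<Sum>a\<in>UNIV. (cmod (x a))\<^sup>2)"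
      unfolding r_def of_real_sum complex_norm_square ..
    with True have "x a = 0" for a
      by (simp add: sum_nonneg_eq_0_iff del: of_real_sum)
    then have "rank_one x = 0" by (simp add: fun_eq_iff rank_one_def)
    then show ?thesis using complex_fun.subspace_0[OF V] by simp
  qed (use scaled in simp)
  then show ?thesis by simp
qed

lemma tensor_deriv_in_commutant:
  fixes W :: "(nat \<Rightarrow> 'N::finite) \<times> (nat \<Rightarrow> 'N) \<Rightarrow> complex"
  assumes "\<And>U. U \<in> unitary_group \<Longrightarrow> tensor_power n U \<in> commutant (tuples n) W"
  shows "tensor_deriv n Y \<in> commutant (tuples n) W"
proof -
  have "complex_fun.span (range rank_one) \<subseteq> tensor_deriv n -` commutant (tuples n) W"
    using tensor_deriv_rank_one_in_commutant[OF assms]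
    by (intro complex_fun.span_minimal subspace_vimage_tensor_deriv subspace_commutant) blast
  then show ?thesis using span_rank_one by blast
qed

section \<open>Moments of Haar unitary matrices\<close>

lemma unitary_group_mult:
  assumes "V \<in> unitary_group" and "U \<in> unitary_group"
  shows "V ** U \<in> unitary_group"
proof -
  have "map_matrix cnj (V ** U) = map_matrix cnj V ** map_matrix cnj U"
    by (simp add: vec_eq_iff map_matrix_def matrix_matrix_mult_def)
  then have "V ** U ** conj_transpose (V ** U) =
      V ** (U ** conj_transpose U) ** conj_transpose V"
    by (simp add: matrix_transpose_mul matrix_mul_assoc)
  also have "\<dots> = mat 1"
    using assms by (simp add: unitary_group_def)
  finally show ?thesis
    unfolding unitary_group_def using matrix_left_right_inverse by blast
qed

lemma compact_unitary_group: "compact (unitary_group :: (complex ^ 'N::finite ^ 'N) set)"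
proof -
  have "norm U = sqrt CARD('N)" if "U \<in> unitary_group" for U :: "complex ^ 'N ^ 'N"
  proof -
    have "norm (U $ a) = 1" for a
    proof -
      have "complex_of_real (\<Sum>c\<in>UNIV. (cmod (U $ a $ c))\<^sup>2) = 1"
        using that unfolding unitary_group_iff of_real_sum complex_norm_square by simp
      then show ?thesis by (simp add: norm_vec_def L2_set_def flip: of_real_sum)
    qed
    then show ?thesis by (simp add: norm_vec_def L2_set_def)
  qed
  then have "bounded (unitary_group :: (complex ^ 'N ^ 'N) set)"
    unfolding bounded_iff by (intro exI[of _ "sqrt CARD('N)"]) simp
  moreover have "closed {U :: complex ^ 'N ^ 'N.
      \<forall>a b. (\<Sum>c\<in>UNIV. U $ a $ c * cnj (U $ b $ c)) = of_bool (a = b)}"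
    by (intro closed_Collect_all closed_Collect_eq continuous_intros)
  moreover have "unitary_group = {U :: complex ^ 'N ^ 'N.
      \<forall>a b. (\<Sum>c\<in>UNIV. U $ a $ c * cnj (U $ b $ c)) = of_bool (a = b)}"
    using unitary_group_iff by blast
  ultimately show ?thesis
    by (simp only: compact_eq_bounded_closed)
qed

lemma tensor_power_mult:
  fixes U V :: "complex ^ 'N::finite ^ 'N"
  shows "tensor_power n (V ** U) = kernel_comp (tuples n) (tensor_power n V) (tensor_power n U)"
proof -
  have "entries (V ** U) = kernel_comp UNIV (entries V) (entries U)"
    by (simp add: fun_eq_iff entries_def kernel_comp_def matrix_matrix_mult_def)
  then show ?thesis by (simp only: kernel_comp_tensor)
qed

lemma tensor_power_conj_transpose:
  "tensor_power n (conj_transpose U) (i, j) = cnj (tensor_power n U (j, i))"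
  by (simp add: tensor_def entries_def transpose_def map_matrix_def)

lemma tensor_power_mat_1: "tensor_power n (mat 1 :: complex ^ 'N ^ 'N) = perm_tensor n id"
proof -
  have "entries (mat 1 :: complex ^ 'N ^ 'N) = id_kernel"
    by (simp add: fun_eq_iff entries_def id_kernel_def mat_def)
  then show ?thesis by (simp only: tensor_id_kernel)
qed

lemma tensor_power_orthonormal:
  fixes U :: "complex ^ 'N::finite ^ 'N"
  assumes "U \<in> unitary_group" and "j \<in> tuples n" and "k \<in> tuples n"
  shows "(\<Sum>i\<in>tuples n. tensor_power n U (i, j) * cnj (tensor_power n U (i, k))) = of_bool (j = k)"
proof -
  have "(\<Sum>i\<in>tuples n. tensor_power n U (i, j) * cnj (tensor_power n U (i, k))) =
      tensor_power n (conj_transpose U ** U) (k, j)"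
    by (simp add: tensor_power_mult kernel_comp_def tensor_power_conj_transpose mult.commute)
  also have "\<dots> = of_bool (j = k)"
    using assms(1) perm_tensor_on_tuples[OF assms(3,2) permutes_id]
    by (auto simp: unitary_group_def tensor_power_mat_1)
  finally show ?thesis .
qed

lemma tensor_power_permute:
  assumes "\<pi> permutes {1..n}"
  shows "tensor_power n U (i \<circ> \<pi>, j) = tensor_power n U (i, j \<circ> inv \<pi>)"
proof -
  have "(\<Prod>k=1..n. U $ i (\<pi> k) $ j (inv \<pi> (\<pi> k))) = (\<Prod>k=1..n. U $ i k $ j (inv \<pi> k))"
    by (rule prod.reindex_bij_betw[OF permutes_imp_bij[OF assms]])
  then show ?thesis
    by (simp add: tensor_def entries_def permutes_inverses[OF assms])
qed

lemma continuous_on_matrix_mult: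
  fixes f g :: "'a::topological_space \<Rightarrow> complex ^ 'N ^ 'N"
  assumes "continuous_on A f" and "continuous_on A g"
  shows "continuous_on A (\<lambda>x. f x ** g x)"
  unfolding matrix_matrix_mult_def by (intro continuous_intros assms)

lemma continuous_on_tensor_power:
  fixes f :: "'a::topological_space \<Rightarrow> complex ^ 'N ^ 'N"
  assumes "continuous_on A f"
  shows "continuous_on A (\<lambda>x. tensor_power n (f x) p)"
  unfolding tensor_def entries_def by (intro continuous_intros assms)

lemmas continuous_on_tensor_power_intros =
  continuous_on_id continuous_on_const continuous_on_mult continuous_on_cnj
  continuous_on_matrix_mult continuous_on_tensor_power

definition haar_moment ::
  "(complex ^ 'N ^ 'N) measure \<Rightarrow> nat \<Rightarrow> (nat \<Rightarrow> 'N) \<times> (nat \<Rightarrow> 'N) \<Rightarrow> (nat \<Rightarrow> 'N) \<times> (nat \<Rightarrow> 'N) \<Rightarrow> complex"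
  where "haar_moment M n q p =
    (LINT U|M. tensor_power n U (fst p, fst q) * cnj (tensor_power n U (snd p, snd q)))"

context
  fixes M :: "(complex ^ 'N::finite ^ 'N) measure"
  assumes haar: "haar_unitary M"
begin

lemma sets_haar: "sets M = sets (restrict_space borel unitary_group)"
  using haar by (simp add: haar_unitary_def)

lemma space_haar: "space M = unitary_group"
  using sets_eq_imp_space_eq[OF sets_haar] by (simp add: space_restrict_space)

lemma prob_space_haar: "prob_space M"
  using haar by (simp add: haar_unitary_def)

lemma measurable_haar:
  fixes f :: "complex ^ 'N ^ 'N \<Rightarrow> 'b::topological_space"
  assumes "continuous_on UNIV f"
  shows "f \<in> borel_measurable M"
  unfolding measurable_cong_sets[OF sets_haar refl]
  by (intro measurable_restrict_space1 borel_measurable_continuous_onI assms)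

lemma integrable_haar:
  fixes f :: "complex ^ 'N ^ 'N \<Rightarrow> 'b::{banach, second_countable_topology}"
  assumes "continuous_on UNIV f"
  shows "integrable M f"
proof -
  interpret prob_space M by (rule prob_space_haar)
  have "compact (f ` unitary_group)"
    using continuous_on_subset[OF assms subset_UNIV] compact_unitary_group
    by (rule compact_continuous_image)
  from compact_imp_bounded[OF this] obtain B where "\<forall>y\<in>f ` unitary_group. norm y \<le> B"
    unfolding bounded_iff by blast
  then have "AE U in M. norm (f U) \<le> B"
    by (intro AE_I2) (simp add: space_haar)
  then show ?thesis
    using measurable_haar[OF assms] by (rule integrable_const_bound)
qed

lemma haar_left_invariant:
  fixes f :: "complex ^ 'N ^ 'N \<Rightarrow> 'b::{banach, second_countable_topology}"
  assumes "V \<in> unitary_group" and "continuous_on UNIV f"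
  shows "(LINT U|M. f (V ** U)) = (LINT U|M. f U)"
proof -
  have "(\<lambda>U. V ** U) \<in> measurable M (restrict_space borel unitary_group)"
    using unitary_group_mult[OF assms(1)]
    by (intro measurable_restrict_space2 measurable_haar continuous_on_tensor_power_intros)
       (auto simp: space_haar)
  then have "(\<lambda>U. V ** U) \<in> measurable M M"
    by (simp add: measurable_cong_sets[OF refl sets_haar])
  from integral_distr[OF this measurable_haar[OF assms(2)]] show ?thesis
    using haar assms(1) by (simp add: haar_unitary_def)
qed

text \<open>The two products with \<open>V\<close> average the same function of \<open>U\<close>, once at \<open>U\<close> and once at \<open>V U\<close>.\<close>

lemma tensor_power_in_commutant_haar_moment:
  assumes "V \<in> unitary_group"
  shows "tensor_power n V \<in> commutant (tuples n) (haar_moment M n q)"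
  unfolding commutant_def mem_Collect_eq
proof
  fix p :: "(nat \<Rightarrow> 'N) \<times> (nat \<Rightarrow> 'N)"
  obtain i k j j' where p: "p = (i, k)" and q: "q = (j, j')" by fastforce
  let ?T = "tensor_power n"
  let ?f = "\<lambda>U. ?T U (i, j) * cnj (?T (conj_transpose V ** U) (k, j'))"
  have integrable: "integrable M (\<lambda>U. ?T U (a, j) * cnj (?T U (b, j')))" for a b
    by (intro integrable_haar continuous_on_tensor_power_intros)
  have "kernel_comp (tuples n) (haar_moment M n q) (?T V) p =
      (LINT U|M. (\<Sum>l\<in>tuples n. ?T U (i, j) * cnj (?T U (l, j')) * ?T V (l, k)))"
    unfolding kernel_comp_def haar_moment_def p q using integrable by simp
  also have "\<dots> = (LINT U|M. ?f U)"
    by (simp add: tensor_power_mult kernel_comp_def tensor_power_conj_transpose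
        sum_distrib_left mult_ac)
  also have "\<dots> = (LINT U|M. ?f (V ** U))"
    by (intro haar_left_invariant[symmetric] assms continuous_on_tensor_power_intros)
  also have "\<dots> = (LINT U|M. ?T (V ** U) (i, j) * cnj (?T U (k, j')))"
    using assms by (simp add: matrix_mul_assoc unitary_group_def)
  also have "\<dots> = (LINT U|M. (\<Sum>l\<in>tuples n. ?T V (i, l) * (?T U (l, j) * cnj (?T U (k, j')))))"
    by (simp add: tensor_power_mult kernel_comp_def sum_distrib_right mult.assoc)
  also have "\<dots> = kernel_comp (tuples n) (?T V) (haar_moment M n q) p"
    unfolding kernel_comp_def haar_moment_def p q using integrable by simp
  finally show "kernel_comp (tuples n) (haar_moment M n q) (?T V) p =
      kernel_comp (tuples n) (?T V) (haar_moment M n q) p" .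
qed

lemma sum_perm_tensor_haar_moment:
  assumes "\<tau> permutes {1..n}" and "q \<in> tuples n \<times> tuples n"
  shows "(\<Sum>p\<in>tuples n \<times> tuples n. perm_tensor n \<tau> p * haar_moment M n q p) = perm_tensor n \<tau> q"
proof -
  interpret prob_space M by (rule prob_space_haar)
  obtain j j' where q: "q = (j, j')" and j: "j \<in> tuples n" and j': "j' \<in> tuples n"
    using assms(2) by blast
  have inv: "j \<circ> inv \<tau> \<in> tuples n"
    by (rule tuples_comp[OF j permutes_inv[OF assms(1)]])
  have "(\<Sum>p\<in>tuples n \<times> tuples n. perm_tensor n \<tau> p * haar_moment M n q p) =
      (\<Sum>i\<in>tuples n. haar_moment M n q (i \<circ> \<tau>, i))"
    by (rule sum_perm_tensor[OF assms(1)])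
  also have "\<dots> = (LINT U|M. (\<Sum>i\<in>tuples n.
      tensor_power n U (i \<circ> \<tau>, j) * cnj (tensor_power n U (i, j'))))"
    unfolding haar_moment_def q fst_conv snd_conv
    by (intro Bochner_Integration.integral_sum[symmetric] integrable_haar
        continuous_on_tensor_power_intros)
  also have "\<dots> = (LINT U|M. of_bool (j \<circ> inv \<tau> = j'))"
    using tensor_power_orthonormal[OF _ inv j']
    by (intro Bochner_Integration.integral_cong refl)
       (simp add: space_haar tensor_power_permute[OF assms(1)])
  also have "\<dots> = perm_tensor n \<tau> q"
    unfolding q perm_tensor_on_tuples[OF j j' assms(1)]
    using comp_permutes_eq_iff[OF assms(1), of j' j] by (auto simp: prob_space)
  finally show ?thesis .
qed

lemma haar_moment_eq:
  assumes "p \<in> tuples n \<times> tuples n" and "q \<in> tuples n \<times> tuples n"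
  shows "haar_moment M n q p =
    (\<Sum>\<sigma>\<in>perms_no_decreasing CARD('N) n. \<Sum>\<tau>\<in>perms_no_decreasing CARD('N) n.
      perm_tensor n \<sigma> p * perm_tensor n \<tau> q *
      inverse_on (perms_no_decreasing CARD('N) n) (gram_matrix CARD('N) n) \<sigma> \<tau>)"
proof -
  have "haar_moment M n q p =
      (\<Sum>p'\<in>tuples n \<times> tuples n. perm_projection n p p' * haar_moment M n q p')"
    by (intro commutant_perm_projection tensor_deriv_in_commutant
        tensor_power_in_commutant_haar_moment assms(1))
  then show ?thesis
    unfolding perm_projection_def sum_gram_kernel_left
    by (simp add: sum_perm_tensor_haar_moment[OF perms_no_decreasing_permutes assms(2)] mult_ac
        cong: sum.cong)
qed

end

theorem theorem3p1:
  fixes n :: nat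
  assumes "n \<ge> 1"
  shows "invertible_on (perms_no_decreasing CARD('N::finite) n) (gram_matrix CARD('N) n) \<and>
    (\<forall>(M :: (complex ^ 'N ^ 'N) measure) (i :: nat \<Rightarrow> 'N) (j :: nat \<Rightarrow> 'N)
        (i' :: nat \<Rightarrow> 'N) (j' :: nat \<Rightarrow> 'N).
      haar_unitary M \<longrightarrow>
      (LINT U|M. (\<Prod>k=1..n. U $ i k $ j k * cnj (U $ i' k $ j' k))) =
      (\<Sum>\<sigma>\<in>perms_no_decreasing CARD('N) n. \<Sum>\<tau>\<in>perms_no_decreasing CARD('N) n.
         of_bool (\<forall>k\<in>{1..n}. i k = (i' \<circ> \<sigma>) k) * of_bool (\<forall>k\<in>{1..n}. j k = (j' \<circ> \<tau>) k) *
         inverse_on (perms_no_decreasing CARD('N) n) (gram_matrix CARD('N) n) \<sigma> \<tau>))"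
proof (intro conjI allI impI gram_matrix_invertible)
  fix M :: "(complex ^ 'N ^ 'N) measure" and i j i' j' :: "nat \<Rightarrow> 'N"
  assume haar: "haar_unitary M"
  let ?S = "perms_no_decreasing CARD('N) n"
  let ?B = "inverse_on ?S (gram_matrix CARD('N) n)"
  let ?r = "\<lambda>f :: nat \<Rightarrow> 'N. restrict f {1..n}"
  have "(LINT U|M. (\<Prod>k=1..n. U $ i k $ j k * cnj (U $ i' k $ j' k))) =
      haar_moment M n (?r j, ?r j') (?r i, ?r i')"
    by (simp add: haar_moment_def tensor_def entries_def prod.distrib)
  also have "\<dots> = (\<Sum>\<sigma>\<in>?S. \<Sum>\<tau>\<in>?S.
      perm_tensor n \<sigma> (?r i, ?r i') * perm_tensor n \<tau> (?r j, ?r j') * ?B \<sigma> \<tau>)"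
    by (intro haar_moment_eq[OF haar] SigmaI restrict_in_tuples)
  also have "\<dots> = (\<Sum>\<sigma>\<in>?S. \<Sum>\<tau>\<in>?S.
      of_bool (\<forall>k\<in>{1..n}. i k = (i' \<circ> \<sigma>) k) * of_bool (\<forall>k\<in>{1..n}. j k = (j' \<circ> \<tau>) k) * ?B \<sigma> \<tau>)"
    by (intro sum.cong refl)
       (simp only: perm_tensor_restrict[OF perms_no_decreasing_permutes], simp add: perm_tensor_def)
  finally show "(LINT U|M. (\<Prod>k=1..n. U $ i k $ j k * cnj (U $ i' k $ j' k))) =
      (\<Sum>\<sigma>\<in>?S. \<Sum>\<tau>\<in>?S.
      of_bool (\<forall>k\<in>{1..n}. i k = (i' \<circ> \<sigma>) k) * of_bool (\<forall>k\<in>{1..n}. j k = (j' \<circ> \<tau>) k) * ?B \<sigma> \<tau>)" .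
qed

end
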